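(* Fix a positive integer $j$. For all $j$-tuple permutation graphs $Q$ of length $k$, $\mathrm{gex}(Q,n)=2^{O(k)}n$. That is, there is a constant $C=C(j)>0$ such that for all positive integers $k,n$ and every $j$-tuple permutation graph $Q$ of length $k$, $\mathrm{gex}(Q,n)\le 2^{Ck}n$.
   Context: Write $[n]=\{1,\dots,n\}$. A graph here means an ordered graph: a linearly ordered vertex set $V$ together with a set $E$ of $2$-element subsets of $V$. A graph $A=(V_1,E_1)$ contains a graph $B=(V_2,E_2)$ if there are an increasing injection $f:V_2\to V_1$ and an injection $g:E_2\to E_1$ with $f(e)\subseteq g(e)$ for every $e\in E_2$; otherwise $A$ avoids $B$. $\mathrm{gex}(Q,n)$ is the maximum number of edges in a graph with $n$ vertices that avoids $Q$. A $j$-tuple permutation matrix of length $k$ is a $k\times kj$ matrix obtained from a $k\times k$ permutation matrix by replacing each $1$-entry with a $1\times j$ matrix of ones and each $0$-entry with a $1\times j$ matrix of zeros. A $j$-tuple permutation graph of length $k$ is the graph associated with a $j$-tuple permutation matrix of length $k$. Here the graph associated with a binary $k_1\times k_2$ matrix $P$ has vertex set $[k_1+k_2]$ and edge set $\{\{a,k_1+b\}: P_{(a,b)}=1\}$. *)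

theory Defs
  imports Complex_Main "Jordan_Normal_Form.Matrix"
begin

type_synonym 'a graph = "'a set \<times> 'a set set"

abbreviation verts :: "'a graph \<Rightarrow> 'a set" where
  "verts \<equiv> fst"

abbreviation edges :: "'a graph \<Rightarrow> 'a set set" where
  "edges \<equiv> snd"

text \<open>The linear order on the vertices is that of the ambient type.\<close>

definition ordered_graph :: "'a::linorder graph \<Rightarrow> bool" where
  "ordered_graph G \<longleftrightarrow> edges G \<subseteq> {e. e \<subseteq> verts G \<and> card e = 2}"

definition contains :: "'a::linorder graph \<Rightarrow> 'b::linorder graph \<Rightarrow> bool" where
  "contains A B \<longleftrightarrow>
    (\<exists>f g. f ` verts B \<subseteq> verts A \<and> strict_mono_on (verts B) f \<and>
           g ` edges B \<subseteq> edges A \<and> inj_on g (edges B) \<and>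
           (\<forall>e \<in> edges B. f ` e \<subseteq> g e))"

abbreviation avoids :: "'a::linorder graph \<Rightarrow> 'b::linorder graph \<Rightarrow> bool" where
  "avoids A B \<equiv> \<not> contains A B"

text \<open>
  Every finite linearly ordered set is order-isomorphic to a set of natural numbers, so
  it is enough to let the graphs in the maximum have vertices in \<^typ>\<open>nat\<close>. The set whose
  maximum is taken is always finite, and it is nonempty as soon as \<open>Q\<close> has an edge
  (see the lemmas below).
\<close>

definition gex_set :: "'b::linorder graph \<Rightarrow> nat \<Rightarrow> nat set" where
  "gex_set Q n = {card (edges G) | G :: nat graph.
     ordered_graph G \<and> finite (verts G) \<and> card (verts G) = n \<and> avoids G Q}"

definition gex :: "'b::linorder graph \<Rightarrow> nat \<Rightarrow> nat" where
  "gex Q n = Max (gex_set Q n)"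

lemma finite_gex_set: "finite (gex_set Q n)"
proof (rule finite_subset)
  show "gex_set Q n \<subseteq> {..n choose 2}"
  proof
    fix m assume "m \<in> gex_set Q n"
    then obtain G :: "nat graph" where G: "m = card (edges G)" "ordered_graph G"
      "finite (verts G)" "card (verts G) = n"
      unfolding gex_set_def by blast
    have "finite {e. e \<subseteq> verts G \<and> card e = 2}"
      using G(3) by simp
    then have "card (edges G) \<le> card {e. e \<subseteq> verts G \<and> card e = 2}"
      using G(2) unfolding ordered_graph_def by (rule card_mono)
    then show "m \<in> {..n choose 2}"
      using n_subsets[OF G(3), of 2] G by simp
  qed
qed simp

lemma gex_set_nonempty:
  assumes "edges Q \<noteq> {}"
  shows "gex_set Q n \<noteq> {}"
proof -
  let ?G = "({1..n}, {}) :: nat graph"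
  have "ordered_graph ?G" "finite (verts ?G)" "card (verts ?G) = n" "avoids ?G Q"
    using assms by (auto simp: ordered_graph_def contains_def)
  then show ?thesis unfolding gex_set_def by blast
qed

text \<open>Matrices of the library are indexed from \<open>0\<close>; graphs of matrices have vertices from \<open>1\<close>.\<close>

definition permutation_matrix :: "nat \<Rightarrow> nat mat \<Rightarrow> bool" where
  "permutation_matrix k P \<longleftrightarrow> P \<in> carrier_mat k k \<and> elements_mat P \<subseteq> {0, 1} \<and>
     (\<forall>a<k. \<exists>!b. b < k \<and> P $$ (a, b) = 1) \<and>
     (\<forall>b<k. \<exists>!a. a < k \<and> P $$ (a, b) = 1)"

text \<open>
  Replacing every entry \<open>c\<close> by the \<open>1 \<times> j\<close> block with all entries \<open>c\<close>: the columns
  \<open>b * j, \<dots>, b * j + (j - 1)\<close> of the new matrix are copies of column \<open>b\<close>.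
\<close>

definition widen :: "nat \<Rightarrow> 'a mat \<Rightarrow> 'a mat" where
  "widen j P = mat (dim_row P) (dim_col P * j) (\<lambda>(a, b). P $$ (a, b div j))"

definition tuple_permutation_matrix :: "nat \<Rightarrow> nat \<Rightarrow> nat mat \<Rightarrow> bool" where
  "tuple_permutation_matrix j k M \<longleftrightarrow> (\<exists>P. permutation_matrix k P \<and> M = widen j P)"

definition graph_of_matrix :: "nat mat \<Rightarrow> nat graph" where
  "graph_of_matrix P =
    ({1..dim_row P + dim_col P},
     {{Suc a, dim_row P + Suc b} | a b. a < dim_row P \<and> b < dim_col P \<and> P $$ (a, b) = 1})"

definition tuple_permutation_graph :: "nat \<Rightarrow> nat \<Rightarrow> nat graph \<Rightarrow> bool" where
  "tuple_permutation_graph j k Q \<longleftrightarrow>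
    (\<exists>M. tuple_permutation_matrix j k M \<and> Q = graph_of_matrix M)"

end

theory Submission
  imports Defs
begin

text \<open>
  The adjacency matrix of an ordered graph is upper triangular. Cut every row of it into chunks of
  \<open>j\<close> consecutive ones. If some \<open>(k + 1) \<times> (k + 1)\<close> grid of disjoint row and column intervals has a
  chunk inside every block, then \<open>Q\<close> is contained: the lower left block forces the first \<open>k\<close> row
  intervals to lie before the last \<open>k\<close> column intervals, and the permutation selects one chunk for each
  row of \<open>Q\<close>.

  A system of chunks without such a grid is bounded by a contraction argument in the style of Marcus
  and Tardos. In a group of \<open>t = 2\<^sup>O\<^sup>(\<^sup>k\<^sup>)\<close> consecutive rows, scan the columns greedily and keep the
  chunks of one row at a time; by Fox's halving lemma only \<open>2\<^sup>O\<^sup>(\<^sup>k\<^sup>)\<close> of the resulting column intervals meet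
  many rows, and on the others only a small factor, at most about \<open>\<surd>t\<close>, is lost. For single points
  the same step applies to rows and to columns, so both dimensions shrink by \<open>t\<close> while the count
  shrinks by at most \<open>t / 2\<close>, up to a linear term. For chunks, the columns are
  contracted instead: the chunks that stay within one column group are counted by the bound for
  points, and all others remain distinct.
\<close>

section \<open>Grid minors of systems of row intervals\<close>

text \<open>
  A triple \<open>(r, c, d)\<close> stands for the interval of columns \<open>c, \<dots>, d\<close> in row \<open>r\<close>.
\<close>

definition grid_minor :: "nat \<Rightarrow> (nat \<times> nat \<times> nat) set \<Rightarrow> bool" where
  "grid_minor k S \<longleftrightarrow> (\<exists>\<rho> \<gamma> :: nat \<Rightarrow> nat. mono \<rho> \<and> mono \<gamma> \<and>
     (\<forall>p<k. \<forall>q<k. \<exists>r c d. (r, c, d) \<in> S \<and> \<rho> p \<le> r \<and> r < \<rho> (Suc p) \<and> \<gamma> q \<le> c \<and> d < \<gamma> (Suc q)))"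

text \<open>
  Common endpoints are allowed, since contracting columns may identify the end of an interval with
  the start of the next one.
\<close>

definition non_overlapping :: "(nat \<times> nat) set \<Rightarrow> bool" where
  "non_overlapping T \<longleftrightarrow> (\<forall>(c, d) \<in> T. c \<le> d) \<and>
     (\<forall>(c, d) \<in> T. \<forall>(c', d') \<in> T. (c, d) \<noteq> (c', d') \<longrightarrow> d \<le> c' \<or> d' \<le> c)"

definition row_disjoint :: "(nat \<times> nat \<times> nat) set \<Rightarrow> bool" where
  "row_disjoint S \<longleftrightarrow> (\<forall>r. non_overlapping {(c, d). (r, c, d) \<in> S})"

lemma row_disjointD:
  assumes "row_disjoint S" "(r, c, d) \<in> S"
  shows "c \<le> d" "(r, c', d') \<in> S \<Longrightarrow> (c, d) \<noteq> (c', d') \<Longrightarrow> d \<le> c' \<or> d' \<le> c"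
  using assms unfolding row_disjoint_def non_overlapping_def by blast+

lemma row_disjoint_subset: "row_disjoint S \<Longrightarrow> S' \<subseteq> S \<Longrightarrow> row_disjoint S'"
  unfolding row_disjoint_def non_overlapping_def by blast

text \<open>A strict bound \<open>r' < \<rho> (Suc p)\<close> means
  \<open>Suc r' \<le> \<rho> (Suc p)\<close>, so the cell of \<open>r'\<close>, which ends before
  \<open>\<phi> (Suc r')\<close>, stays inside the block cut out by
  \<open>\<phi> \<circ> \<rho>\<close>; columns behave alike. This is how the absence of a grid
  passes from a system to its contractions.\<close>

lemma grid_minor_map:
  assumes "grid_minor k S'" "mono \<phi>" "mono \<psi>"
    and lift: "\<And>r' c' d'. (r', c', d') \<in> S' \<Longrightarrow> \<exists>r c d. (r, c, d) \<in> S \<and>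
           \<phi> r' \<le> r \<and> r < \<phi> (Suc r') \<and> \<psi> c' \<le> c \<and> d < \<psi> (Suc d')"
  shows "grid_minor k S"
proof -
  obtain \<rho> \<gamma> where mono: "mono \<rho>" "mono \<gamma>"
    and blocks: "\<And>p q. p < k \<Longrightarrow> q < k \<Longrightarrow> \<exists>r c d. (r, c, d) \<in> S' \<and>
            \<rho> p \<le> r \<and> r < \<rho> (Suc p) \<and> \<gamma> q \<le> c \<and> d < \<gamma> (Suc q)"
    using assms(1) unfolding grid_minor_def by blast
  have "\<exists>r c d. (r, c, d) \<in> S \<and> (\<phi> \<circ> \<rho>) p \<le> r \<and> r < (\<phi> \<circ> \<rho>) (Suc p) \<and>
          (\<psi> \<circ> \<gamma>) q \<le> c \<and> d < (\<psi> \<circ> \<gamma>) (Suc q)" if pq: "p < k" "q < k" for p q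
  proof -
    obtain r' c' d' where 1: "(r', c', d') \<in> S'" "\<rho> p \<le> r'" "Suc r' \<le> \<rho> (Suc p)"
        "\<gamma> q \<le> c'" "Suc d' \<le> \<gamma> (Suc q)"
      using blocks[OF pq] by (auto simp: Suc_le_eq)
    obtain r c d where 2: "(r, c, d) \<in> S" "\<phi> r' \<le> r" "r < \<phi> (Suc r')" "\<psi> c' \<le> c" "d < \<psi> (Suc d')"
      using lift[OF 1(1)] by blast
    have "\<phi> (\<rho> p) \<le> r" "r < \<phi> (\<rho> (Suc p))" "\<psi> (\<gamma> q) \<le> c" "d < \<psi> (\<gamma> (Suc q))"
      using 2 monoD[OF assms(2) 1(2)] monoD[OF assms(2) 1(3)]
        monoD[OF assms(3) 1(4)] monoD[OF assms(3) 1(5)] by linarith+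
    then show ?thesis using 2(1) by auto
  qed
  moreover have "mono (\<phi> \<circ> \<rho>)" "mono (\<psi> \<circ> \<gamma>)"
    using mono assms(2,3) by (auto simp: mono_def)
  ultimately show ?thesis unfolding grid_minor_def by blast
qed

section \<open>Extracting grids from dense families of lines\<close>

lemma mono_case_nat: "mono f \<Longrightarrow> x \<le> f 0 \<Longrightarrow> mono (case_nat x f)" for f :: "nat \<Rightarrow> nat"
  unfolding mono_iff_le_Suc by (auto split: nat.splits)

lemma split_by_cuts:
  fixes I :: "nat set"
  assumes "finite I" "k \<le> card I"
  shows "\<exists>\<rho> :: nat \<Rightarrow> nat. mono \<rho> \<and> (\<forall>p<k. \<exists>i\<in>I. \<rho> p \<le> i \<and> i < \<rho> (Suc p))"
  using assms
proof (induction k arbitrary: I)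
  case 0
  show ?case by (rule exI[of _ "\<lambda>_. 0"]) (simp add: mono_def)
next
  case (Suc k)
  have ne: "I \<noteq> {}" using Suc.prems by auto
  let ?m = "Min I"
  have "k \<le> card (I - {?m})" using Suc.prems ne by simp
  then obtain \<rho> where \<rho>: "mono \<rho>" "\<forall>p<k. \<exists>i\<in>I - {?m}. \<rho> p \<le> i \<and> i < \<rho> (Suc p)"
    using Suc.IH[of "I - {?m}"] Suc.prems by auto
  \<comment> \<open>The maximum keeps \<open>?m\<close> alone in front of the later cuts and loses
    no other element, since all the others exceed \<open>?m\<close>.\<close>
  define \<sigma> where "\<sigma> = case_nat ?m (\<lambda>p. max (Suc ?m) (\<rho> p))"
  have "mono (\<lambda>p. max (Suc ?m) (\<rho> p))"
    using \<rho>(1) by (intro monoI max.mono order_refl) (rule monoD)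
  then have "mono \<sigma>" unfolding \<sigma>_def by (rule mono_case_nat) auto
  moreover have "\<exists>i\<in>I. \<sigma> p \<le> i \<and> i < \<sigma> (Suc p)" if "p < Suc k" for p
  proof (cases p)
    case 0
    then show ?thesis using Min_in[OF Suc.prems(1) ne] by (auto simp: \<sigma>_def intro!: bexI[of _ ?m])
  next
    case (Suc p')
    with that \<rho>(2) obtain i where i: "i \<in> I - {?m}" "\<rho> p' \<le> i" "i < \<rho> (Suc p')" by auto
    then have "?m < i" using Suc.prems(1) by (metis DiffD1 DiffD2 Min_le insertI1 le_neq_implies_less)
    with i Suc show ?thesis by (auto simp: \<sigma>_def intro!: bexI[of _ i])
  qed
  ultimately show ?case by blast
qed

text \<open>
  Fox's halving argument: a line either keeps \<open>2 ^ b\<close> points in one half of the columns, or has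
  \<open>2 ^ (b - 1)\<close> points in one half and some point in the other, which then serves as one
  further column interval.
\<close>

lemma dense_lines_minor:
  fixes D :: "nat \<Rightarrow> nat set"
  assumes "finite I" "1 \<le> l" "l \<le> Suc b" "k * 4 ^ a \<le> card I" 
    and "\<And>i. i \<in> I \<Longrightarrow> 2 ^ b \<le> card (D i \<inter> {u..<u + 2 ^ a})"
  shows "\<exists>\<rho> \<gamma> :: nat \<Rightarrow> nat. mono \<rho> \<and> mono \<gamma> \<and> (\<forall>q. u \<le> \<gamma> q \<and> \<gamma> q \<le> u + 2 ^ a) \<and>
     (\<forall>p<k. \<forall>q<l. \<exists>i\<in>I. \<rho> p \<le> i \<and> i < \<rho> (Suc p) \<and> (\<exists>e\<in>D i. \<gamma> q \<le> e \<and> e < \<gamma> (Suc q)))"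
  using assms
proof (induction a arbitrary: b l I u)
  case 0
  show ?case
  proof (cases "k = 0")
    case True
    then show ?thesis by (intro exI[of _ "\<lambda>_. u"]) (simp add: mono_def)
  next
    case False
    then have "I \<noteq> {}" using 0 by auto
    then obtain i where "i \<in> I" by auto
    then have "2 ^ b \<le> card (D i \<inter> {u..<u + 1})" using 0 by auto
    also have "\<dots> \<le> card {u..<u+1}" by (intro card_mono) auto
    finally have "2 ^ b \<le> (1::nat)" by simp
    \<comment> \<open>A window of one column holds at most one point. With
      \<open>l \<le> Suc b\<close>, a single column block remains to be found.\<close>
    then have "b = 0" using less_exp[of b] by linarith
    then have l: "l = 1" using 0 by auto
    have u: "u \<in> D i" if "i \<in> I" for i
    proof -
      have "0 < card (D i \<inter> {u..<u + 2 ^ 0})"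
        using 0(5)[OF that] by (rule order.strict_trans2[rotated]) simp
      then have "D i \<inter> {u..<u + 2 ^ 0} \<noteq> {}" by (metis card.empty less_irrefl)
      then show ?thesis by auto
    qed
    obtain \<rho> :: "nat \<Rightarrow> nat" where "mono \<rho>" "\<forall>p<k. \<exists>i\<in>I. \<rho> p \<le> i \<and> i < \<rho> (Suc p)"
      using split_by_cuts[of I k] 0 by auto
    moreover have "mono (case_nat u (\<lambda>_. Suc u))"
      by (rule mono_case_nat) (auto simp: mono_def)
    moreover have "\<forall>q. u \<le> case_nat u (\<lambda>_. Suc u) q \<and> case_nat u (\<lambda>_. Suc u) q \<le> u + 2 ^ 0"
      by (auto split: nat.splits)
    moreover have "\<forall>p<k. \<forall>q<l. \<exists>i\<in>I. \<rho> p \<le> i \<and> i < \<rho> (Suc p) \<and>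
        (\<exists>e\<in>D i. case_nat u (\<lambda>_. Suc u) q \<le> e \<and> e < case_nat u (\<lambda>_. Suc u) (Suc q))"
      using u l calculation(2) by fastforce
    ultimately show ?thesis by blast
  qed
next
  case (Suc a)
  let ?w = "u + 2 ^ a"
  have wle: "?w \<le> u + 2 ^ Suc a" and weq: "?w + 2 ^ a = u + 2 ^ Suc a" by simp_all
  let ?L = "\<lambda>i. D i \<inter> {u..<?w}" and ?R = "\<lambda>i. D i \<inter> {?w..<?w + 2 ^ a}"
  show ?case
  proof (cases "l = 1")
    case True
    \<comment> \<open>The only column block can be the whole window, so it suffices to separate the
      lines.\<close>
    have "k \<le> card I"
    proof (rule order_trans[OF _ Suc.prems(4)])
      show "k \<le> k * 4 ^ Suc a" by simp
    qed
    then obtain \<rho> :: "nat \<Rightarrow> nat" where \<rho>: "mono \<rho>" "\<forall>p<k. \<exists>i\<in>I. \<rho> p \<le> i \<and> i < \<rho> (Suc p)"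
      using split_by_cuts[of I k] Suc by auto
    have e: "\<exists>e\<in>D i. u \<le> e \<and> e < u + 2 ^ Suc a" if "i \<in> I" for i
    proof -
      have "card (D i \<inter> {u..<u + 2 ^ Suc a}) > 0"
        using Suc.prems(5)[OF that] by (rule order.strict_trans2[rotated]) simp
      then have "D i \<inter> {u..<u + 2 ^ Suc a} \<noteq> {}" by (metis card.empty less_irrefl)
      then show ?thesis by auto
    qed
    show ?thesis
    proof (intro exI conjI allI impI)
      show "mono \<rho>" by fact
      show "mono (case_nat u (\<lambda>_. u + 2 ^ Suc a))" by (rule mono_case_nat) (auto simp: mono_def)
    next
      fix p q assume "p < k" "q < l"
      then have "q = 0" using True by simp
      then show "\<exists>i\<in>I. \<rho> p \<le> i \<and> i < \<rho> (Suc p) \<and>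
         (\<exists>e\<in>D i. case_nat u (\<lambda>_. u + 2 ^ Suc a) q \<le> e \<and> e < case_nat u (\<lambda>_. u + 2 ^ Suc a) (Suc q))"
        using \<rho>(2) \<open>p < k\<close> e by fastforce
    qed (auto split: nat.splits)
  next
    case False
    then obtain l' where l': "l = Suc l'" "1 \<le> l'" using Suc.prems(2) by (cases l) auto
    then obtain b' where b': "b = Suc b'" using Suc.prems(3) by (cases b) auto
    define I1 where "I1 = {i\<in>I. 2 ^ b \<le> card (?L i)}"
    define I2 where "I2 = {i\<in>I. 2 ^ b \<le> card (?R i)}"
    define I3 where "I3 = {i\<in>I. 2 ^ b' \<le> card (?L i) \<and> ?R i \<noteq> {}}"
    define I4 where "I4 = {i\<in>I. 2 ^ b' \<le> card (?R i) \<and> ?L i \<noteq> {}}"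
    have cover: "I \<subseteq> I1 \<union> I2 \<union> I3 \<union> I4"
    proof
      fix i assume i: "i \<in> I"
      have "D i \<inter> {u..<u + 2 ^ Suc a} = ?L i \<union> ?R i" by auto
      then have "2 ^ b \<le> card (?L i \<union> ?R i)" using Suc.prems(5)[OF i] by metis
      also have "\<dots> \<le> card (?L i) + card (?R i)" by (rule card_Un_le)
      finally have sum: "2 ^ b \<le> card (?L i) + card (?R i)" .
      then have "2 ^ b' \<le> card (?L i) \<or> 2 ^ b' \<le> card (?R i)" using b' by auto
      moreover have "?R i = {} \<Longrightarrow> 2 ^ b \<le> card (?L i)" "?L i = {} \<Longrightarrow> 2 ^ b \<le> card (?R i)"
        using sum by (metis add_0_right add_0 card.empty)+
      ultimately show "i \<in> I1 \<union> I2 \<union> I3 \<union> I4"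
        using i unfolding I1_def I2_def I3_def I4_def by blast
    qed
    have fin: "finite I1" "finite I2" "finite I3" "finite I4"
      using Suc.prems(1) by (simp_all add: I1_def I2_def I3_def I4_def)
    have "card I \<le> card (I1 \<union> I2 \<union> I3 \<union> I4)" using cover fin by (intro card_mono) auto
    also have "\<dots> \<le> card I1 + card I2 + card I3 + card I4"
      by (meson card_Un_le add_le_mono1 order_trans)
    \<comment> \<open>The four classes share at least \<open>4 * (k * 4 ^ a)\<close> lines, so one
      of them is large enough for a window of half the width.\<close>
    finally consider "k * 4 ^ a \<le> card I1" | "k * 4 ^ a \<le> card I2" | "k * 4 ^ a \<le> card I3" | "k * 4 ^ a \<le> card I4"
      using Suc.prems(4) by fastforce
    then show ?thesis
    proof cases
      case 1
      obtain \<rho> \<gamma> :: "nat \<Rightarrow> nat" where *: "mono \<rho>" "mono \<gamma>" "\<forall>q. u \<le> \<gamma> q \<and> \<gamma> q \<le> u + 2 ^ a"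
          "\<forall>p<k. \<forall>q<l. \<exists>i\<in>I1. \<rho> p \<le> i \<and> i < \<rho> (Suc p) \<and> (\<exists>e\<in>D i. \<gamma> q \<le> e \<and> e < \<gamma> (Suc q))"
        using Suc.IH[OF fin(1) Suc.prems(2,3) 1, of u] unfolding I1_def by blast
      have "\<forall>q. u \<le> \<gamma> q \<and> \<gamma> q \<le> u + 2 ^ Suc a" using *(3) wle by (meson order_trans)
      moreover have "I1 \<subseteq> I" by (auto simp: I1_def)
      ultimately show ?thesis using * by (meson subsetD)
    next
      case 2
      obtain \<rho> \<gamma> :: "nat \<Rightarrow> nat" where *: "mono \<rho>" "mono \<gamma>" "\<forall>q. ?w \<le> \<gamma> q \<and> \<gamma> q \<le> ?w + 2 ^ a"
          "\<forall>p<k. \<forall>q<l. \<exists>i\<in>I2. \<rho> p \<le> i \<and> i < \<rho> (Suc p) \<and> (\<exists>e\<in>D i. \<gamma> q \<le> e \<and> e < \<gamma> (Suc q))"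
        using Suc.IH[OF fin(2) Suc.prems(2,3) 2, of ?w] unfolding I2_def by blast
      have "\<forall>q. u \<le> \<gamma> q \<and> \<gamma> q \<le> u + 2 ^ Suc a"
        using *(3) unfolding weq by (meson add_leD1)
      moreover have "I2 \<subseteq> I" by (auto simp: I2_def)
      ultimately show ?thesis using * by (meson subsetD)
    next
      case 3
      obtain \<rho> \<gamma> :: "nat \<Rightarrow> nat" where *: "mono \<rho>" "mono \<gamma>" "\<forall>q. u \<le> \<gamma> q \<and> \<gamma> q \<le> ?w"
          "\<forall>p<k. \<forall>q<l'. \<exists>i\<in>I3. \<rho> p \<le> i \<and> i < \<rho> (Suc p) \<and> (\<exists>e\<in>D i. \<gamma> q \<le> e \<and> e < \<gamma> (Suc q))"
        using Suc.IH[OF fin(3) l'(2) _ 3, of b' u] Suc.prems(3) l' b' unfolding I3_def by auto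
      \<comment> \<open>Block \<open>l'\<close> runs from \<open>\<gamma> l' \<le> ?w\<close> to the
        end of the window, so it contains the whole right half. For this purpose the induction
        confines all cuts to their window.\<close>
      define \<delta> where "\<delta> = (\<lambda>q. if q \<le> l' then \<gamma> q else u + 2 ^ Suc a)"
      have up: "\<gamma> q \<le> u + 2 ^ Suc a" for q using *(3) wle by (meson order_trans)
      have "mono \<delta>" using *(2) up by (auto simp: mono_def \<delta>_def)
      moreover have "\<forall>q. u \<le> \<delta> q \<and> \<delta> q \<le> u + 2 ^ Suc a" using up *(3) by (auto simp: \<delta>_def)
      moreover have "\<exists>i\<in>I. \<rho> p \<le> i \<and> i < \<rho> (Suc p) \<and> (\<exists>e\<in>D i. \<delta> q \<le> e \<and> e < \<delta> (Suc q))"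
        if p: "p < k" and q: "q < l" for p q
      proof (cases "q < l'")
        case True
        then show ?thesis using *(4) p by (fastforce simp: \<delta>_def I3_def)
      next
        case False
        then have q: "q = l'" using q l' by auto
        obtain i where i: "i \<in> I3" "\<rho> p \<le> i" "i < \<rho> (Suc p)" using *(4) p l'(2) by force
        then obtain e where e: "e \<in> D i" "?w \<le> e" "e < ?w + 2 ^ a" unfolding I3_def by auto
        have "\<delta> q \<le> e" "e < \<delta> (Suc q)"
          using q e *(3) by (auto simp: \<delta>_def intro: order_trans)
        then show ?thesis using i e unfolding I3_def by blast
      qed
      ultimately show ?thesis using *(1) by blast
    next
      case 4
      obtain \<rho> \<gamma> :: "nat \<Rightarrow> nat" where *: "mono \<rho>" "mono \<gamma>" "\<forall>q. ?w \<le> \<gamma> q \<and> \<gamma> q \<le> ?w + 2 ^ a"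
          "\<forall>p<k. \<forall>q<l'. \<exists>i\<in>I4. \<rho> p \<le> i \<and> i < \<rho> (Suc p) \<and> (\<exists>e\<in>D i. \<gamma> q \<le> e \<and> e < \<gamma> (Suc q))"
        using Suc.IH[OF fin(4) l'(2) _ 4, of b' ?w] Suc.prems(3) l' b' unfolding I4_def by auto
      \<comment> \<open>The new first block starts at \<open>u\<close> and reaches
        \<open>\<gamma> 0 \<ge> ?w\<close>, so it contains the whole left half.\<close>
      define \<delta> where "\<delta> = case_nat u \<gamma>"
      have lo: "u \<le> \<gamma> q" for q using *(3) by (auto intro: add_leD1)
      have "mono \<delta>" unfolding \<delta>_def using *(2) lo by (intro mono_case_nat)
      moreover have "\<forall>q. u \<le> \<delta> q \<and> \<delta> q \<le> u + 2 ^ Suc a"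
        using lo *(3) unfolding weq \<delta>_def by (auto split: nat.splits)
      moreover have "\<exists>i\<in>I. \<rho> p \<le> i \<and> i < \<rho> (Suc p) \<and> (\<exists>e\<in>D i. \<delta> q \<le> e \<and> e < \<delta> (Suc q))"
        if p: "p < k" and q: "q < l" for p q
      proof (cases q)
        case (Suc q')
        then show ?thesis using *(4) p q l' by (fastforce simp: \<delta>_def I4_def)
      next
        case 0
        obtain i where i: "i \<in> I4" "\<rho> p \<le> i" "i < \<rho> (Suc p)" using *(4) p l'(2) by force
        then obtain e where e: "e \<in> D i" "u \<le> e" "e < ?w" unfolding I4_def by auto
        have "\<delta> q \<le> e" "e < \<delta> (Suc q)"
          using 0 e *(3) by (auto simp: \<delta>_def intro: order.strict_trans2)
        then show ?thesis using i e unfolding I4_def by blast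
      qed
      ultimately show ?thesis using *(1) by blast
    qed
  qed
qed

section \<open>Contracting groups of rows\<close>

text \<open>Touching intervals of one row may share \<open>y\<close>. Whether an interval extends
  strictly to the left and strictly to the right of \<open>y\<close> determines it within its row,
  which leaves at most four per row.\<close>

lemma card_piercing_le:
  assumes "row_disjoint S" "\<And>r c d. (r, c, d) \<in> S \<Longrightarrow> r \<in> {u..<u + t}"
  shows "finite {(r, c, d) \<in> S. c \<le> y \<and> y \<le> d}" (is "finite ?P")
    and "card {(r, c, d) \<in> S. c \<le> y \<and> y \<le> d} \<le> 4 * t"
proof -
  let ?f = "\<lambda>(r :: nat, c, d). (r, c < y, y < d)"
  let ?B = "{u..<u + t} \<times> {True, False} \<times> {True, False}"
  have inj: "inj_on ?f ?P"
  proof (rule inj_onI)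
    fix z z'
    assume z: "z \<in> ?P" "z' \<in> ?P" "?f z = ?f z'"
    obtain r c d r' c' d' where eq: "z = (r, c, d)" "z' = (r', c', d')" by (metis prod_cases3)
    with z have *: "r' = r" "(r, c, d) \<in> S" "(r, c', d') \<in> S" "c \<le> y" "y \<le> d" "c' \<le> y" "y \<le> d'"
      "(c < y) = (c' < y)" "(y < d) = (y < d')" by auto
    then show "z = z'"
      using row_disjointD(2)[OF assms(1) *(2,3)] unfolding eq by (cases "c = c'"; cases "d = d'") auto
  qed
  have sub: "?f ` ?P \<subseteq> ?B" using assms(2) by fastforce
  have "finite ?B" by simp
  then show "finite ?P" using inj sub by (meson finite_imageD finite_subset)
  have "card ?P \<le> card ?B" using card_inj_on_le[OF inj sub] by simp
  then show "card ?P \<le> 4 * t" by (simp add: card_cartesian_product)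
qed

lemma card_Sigma_le:
  assumes "finite A" "\<And>a. a \<in> A \<Longrightarrow> finite (B a) \<and> card (B a) \<le> m"
  shows "card (Sigma A B) \<le> card A * m"
proof -
  have "card (Sigma A B) = (\<Sum>a\<in>A. card (B a))" using assms by (intro card_SigmaI) auto
  also have "\<dots> \<le> card A * m" using sum_bounded_above[of A "\<lambda>a. card (B a)" m] assms by simp
  finally show ?thesis .
qed

text \<open>
  Greedy scan from column \<open>x\<close>: stop as soon as some row has \<open>t\<close> intervals inside the scanned part.
  If at least \<open>s\<close> rows have an interval there, record a cut in \<open>X\<close>; otherwise put the
  intervals of that row into \<open>T\<close>, which pays for the at most \<open>s * t\<close> intervals inside
  the part and the at most \<open>4 * t\<close> intervals meeting its last column.
\<close>

lemma strip_selection: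
  fixes S :: "(nat \<times> nat \<times> nat) set"
  assumes "finite S" "row_disjoint S" "1 \<le> t"
    and rows: "\<And>r c d. (r, c, d) \<in> S \<Longrightarrow> r \<in> {u..<u + t}"
  shows "\<exists>T X N. T \<subseteq> {(c, d). \<exists>r. (r, c, d) \<in> S \<and> x \<le> c} \<and> non_overlapping T \<and>
     mono X \<and> x \<le> X 0 \<and>
     (\<forall>i<N. s \<le> card {r. \<exists>c d. (r, c, d) \<in> S \<and> X i \<le> c \<and> d < X (Suc i)}) \<and>
     card {(r, c, d) \<in> S. x \<le> c} \<le> (N + 1) * (t * t + 4 * t) + (s + 4) * card T"
proof (induction "card {(r, c, d) \<in> S. x \<le> c}" arbitrary: x rule: less_induct)
  case less
  define row where "row = (\<lambda>r y. {(c, d). (r, c, d) \<in> S \<and> x \<le> c \<and> d < y})"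
  let ?S = "\<lambda>x. {(r, c, d) \<in> S. x \<le> c}"
  have finrow: "finite (row r y)" for r y
    by (rule finite_subset[of _ "snd ` S"]) (force simp: row_def \<open>finite S\<close>)+
  have fin: "finite (?S x)" for x by (rule finite_subset[OF _ \<open>finite S\<close>]) auto
  show ?case
  proof (cases "\<exists>y r. t \<le> card (row r y)")
    case False
    \<comment> \<open>No row ever collects \<open>t\<close> intervals, so at most
      \<open>t * t\<close> are left; the extra \<open>1\<close> in \<open>N + 1\<close> pays for
      them without a further cut.\<close>
    define Y where "Y = Suc (Max ((\<lambda>(r, c, d). d) ` S))"
    have Y: "d < Y" if "(r, c, d) \<in> S" for r c d
      unfolding Y_def less_Suc_eq_le using that \<open>finite S\<close>
      by (intro Max_ge) (force intro: image_eqI)+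
    have "?S x \<subseteq> Sigma {u..<u + t} (\<lambda>r. row r Y)" using rows Y by (auto simp: row_def)
    then have "card (?S x) \<le> card (Sigma {u..<u + t} (\<lambda>r. row r Y))"
      using finrow by (intro card_mono) auto
    also have "\<dots> \<le> card {u..<u + t} * t" using False finrow
      by (intro card_Sigma_le) (auto simp: not_le intro: less_imp_le)
    finally have "card (?S x) \<le> (0 + 1) * (t * t + 4 * t) + (s + 4) * card ({} :: (nat \<times> nat) set)" by simp
    then show ?thesis
      by (intro exI[of _ "{}"] exI[of _ "\<lambda>_. x"] exI[of _ 0])
         (auto simp: non_overlapping_def mono_def)
  next
    case True
    \<comment> \<open>The first bound at which some row collects \<open>t\<close> intervals; one
      column earlier, at \<open>y'\<close>, no row has more than \<open>t\<close>.\<close>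
    define y where "y = (LEAST y. \<exists>r. t \<le> card (row r y))"
    have "\<exists>r. t \<le> card (row r y)" unfolding y_def using True by (rule LeastI_ex)
    then obtain r0 where r0: "t \<le> card (row r0 y)" ..
    have "row r0 0 = {}" by (auto simp: row_def)
    with r0 \<open>1 \<le> t\<close> have "y \<noteq> 0" by (metis card.empty not_one_le_zero le_trans)
    then obtain y' where y': "y = Suc y'" by (cases y) auto
    have small: "card (row r y') \<le> t" for r
      using not_less_Least[of y' "\<lambda>y. \<exists>r. t \<le> card (row r y)"] y'
      unfolding y_def[symmetric] by (auto simp: not_le intro: less_imp_le)
    define R where "R = {r. row r y \<noteq> {}}"
    have R: "R \<subseteq> {u..<u + t}" using rows by (auto simp: R_def row_def)
    then have finR: "finite R" by (rule finite_subset) simp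
    let ?P = "{(r, c, d) \<in> S. c \<le> y' \<and> y' \<le> d}"
    let ?M = "Sigma R (\<lambda>r. row r y')"
    \<comment> \<open>An interval counted from \<open>x\<close> starts at \<open>y\<close> or later,
      ends before \<open>y'\<close>, or contains \<open>y'\<close>. Only rows of \<open>R\<close>
      have intervals of the middle kind.\<close>
    have "?S x \<subseteq> ?S y \<union> ?M \<union> ?P"
    proof
      fix z assume "z \<in> ?S x"
      then obtain r c d where z: "z = (r, c, d)" "(r, c, d) \<in> S" "x \<le> c" by auto
      show "z \<in> ?S y \<union> ?M \<union> ?P"
      proof (cases "d < y'")
        case True
        with z have "(c, d) \<in> row r y'" "(c, d) \<in> row r y" by (auto simp: row_def y')
        then show ?thesis using z by (auto simp: R_def)
      qed (use z y' in auto)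
    qed
    then have "card (?S x) \<le> card (?S y \<union> ?M \<union> ?P)"
      using fin[of y] finR finrow card_piercing_le(1)[OF assms(2) rows] by (intro card_mono) auto
    also have "\<dots> \<le> card (?S y) + card ?M + card ?P"
      by (meson card_Un_le add_le_mono1 order_trans)
    also have "\<dots> \<le> card (?S y) + card R * t + 4 * t"
      using card_piercing_le(2)[OF assms(2) rows, where y = y'] small finrow
        card_Sigma_le[OF finR, of "\<lambda>r. row r y'" t] by fastforce
    finally have step: "card (?S x) \<le> card (?S y) + card R * t + 4 * t" .
    have "row r0 y \<noteq> {}" using r0 \<open>1 \<le> t\<close> by (metis card.empty not_one_le_zero le_trans)
    then obtain c0 d0 where cd0: "(r0, c0, d0) \<in> S" "x \<le> c0" "d0 < y" by (auto simp: row_def)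
    then have "c0 < y" using row_disjointD(1)[OF assms(2)] by fastforce
    then have xy: "x \<le> y" using cd0 by simp
    \<comment> \<open>This interval is counted from \<open>x\<close> but not from \<open>y\<close>,
      so the induction measure drops.\<close>
    have "(r0, c0, d0) \<in> ?S x" "(r0, c0, d0) \<notin> ?S y" "?S y \<subseteq> ?S x"
      using xy cd0 \<open>c0 < y\<close> by auto
    then have "?S y \<subset> ?S x" by blast
    then have "card (?S y) < card (?S x)" by (rule psubset_card_mono[OF fin])
    from less[OF this] obtain T X N where IH: "T \<subseteq> {(c, d). \<exists>r. (r, c, d) \<in> S \<and> y \<le> c}"
      "non_overlapping T" "mono X" "y \<le> X 0"
      "\<And>i. i < N \<Longrightarrow> s \<le> card {r. \<exists>c d. (r, c, d) \<in> S \<and> X i \<le> c \<and> d < X (Suc i)}"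
      "card (?S y) \<le> (N + 1) * (t * t + 4 * t) + (s + 4) * card T" by blast
    show ?thesis
    proof (cases "s \<le> card R")
      case True
      \<comment> \<open>The recursive cuts start at \<open>y\<close> or later, so the strip from
        \<open>x\<close> to \<open>X 0\<close> contains the scanned part and meets all rows of
        \<open>R\<close>.\<close>
      let ?X = "case_nat x X"
      have "mono ?X" using IH xy by (intro mono_case_nat) auto
      moreover have "s \<le> card {r. \<exists>c d. (r, c, d) \<in> S \<and> ?X i \<le> c \<and> d < ?X (Suc i)}"
        if "i < Suc N" for i
      proof (cases i)
        case 0
        have "R \<subseteq> {r. \<exists>c d. (r, c, d) \<in> S \<and> ?X i \<le> c \<and> d < ?X (Suc i)}"
          using 0 order.strict_trans2[OF _ IH(4)] unfolding R_def row_def by auto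
        moreover have "{r. \<exists>c d. (r, c, d) \<in> S \<and> ?X i \<le> c \<and> d < ?X (Suc i)} \<subseteq> {u..<u + t}"
          using rows by blast
        ultimately show ?thesis using True
          by (meson card_mono finite_atLeastLessThan finite_subset order_trans)
      qed (use IH(5) that in auto)
      moreover have "card (?S x) \<le> (Suc N + 1) * (t * t + 4 * t) + (s + 4) * card T"
      proof -
        have "card R \<le> t" using card_mono[OF _ R] by simp
        then have "card R * t \<le> t * t" by (rule mult_right_mono) simp
        moreover have "(Suc N + 1) * (t * t + 4 * t) = (N + 1) * (t * t + 4 * t) + (t * t + 4 * t)" by simp
        ultimately show ?thesis using step IH(6) by linarith
      qed
      ultimately show ?thesis using IH(1,2) xy
        by (intro exI[of _ T] exI[of _ ?X] exI[of _ "Suc N"]) (auto intro: order_trans)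
    next
      case False
      let ?T = "T \<union> row r0 y"
      have far: "y \<le> c" if "(c, d) \<in> T" for c d using IH(1) that by auto
      have near: "c \<le> d" "d < y" if "(c, d) \<in> row r0 y" for c d
        using that row_disjointD(1)[OF assms(2)] by (auto simp: row_def)
      have "T \<inter> row r0 y = {}" using far near by fastforce
      moreover have "finite T"
        by (rule finite_subset[of _ "snd ` S"]) (use IH(1) \<open>finite S\<close> in force)+
      ultimately have cT: "card ?T \<ge> card T + t" using r0 finrow by (simp add: card_Un_disjoint)
      have sub: "?T \<subseteq> {(c, d). \<exists>r. (r, c, d) \<in> S \<and> x \<le> c}"
        using IH(1) xy unfolding row_def by fastforce
      have no_row: "non_overlapping (row r0 y)"
        using assms(2) unfolding row_disjoint_def non_overlapping_def row_def by blast
      have "non_overlapping ?T"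
        unfolding non_overlapping_def
      proof (intro conjI ballI, goal_cases)
        case (1 z)
        then show ?case using near(1) IH(2) unfolding non_overlapping_def by fast
      next
        case (2 z)
        obtain c d where z: "z = (c, d)" by (cases z)
        show ?case unfolding z prod.case
        proof (clarify, goal_cases)
          case (1 c' d')
          have less: "e \<le> e'" if "(b, e) \<in> row r0 y" "(e', b') \<in> T" for b e e' b'
            using near(2)[OF that(1)] far[OF that(2)] by simp
          consider "(c, d) \<in> T" "(c', d') \<in> T" | "(c, d) \<in> row r0 y" "(c', d') \<in> row r0 y"
            | "(c, d) \<in> row r0 y" "(c', d') \<in> T" | "(c', d') \<in> row r0 y" "(c, d) \<in> T"
            using 2 1 z by blast
          then show ?case
          proof cases
            case a: 1
            then show ?thesis using IH(2) 1 unfolding non_overlapping_def by fast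
          next
            case a: 2
            then show ?thesis using no_row 1 unfolding non_overlapping_def by fast
          next
            case 3
            then show ?thesis using less 1 by blast
          next
            case 4
            then show ?thesis using less 1 by blast
          qed
        qed
      qed
      moreover have "card (?S x) \<le> (N + 1) * (t * t + 4 * t) + (s + 4) * card ?T"
      proof -
        have "card R * t \<le> s * t" using False by (intro mult_right_mono) auto
        moreover have "(s + 4) * (card T + t) \<le> (s + 4) * card ?T" using cT by (intro mult_left_mono) auto
        moreover have "(s + 4) * (card T + t) = (s + 4) * card T + s * t + 4 * t" by (simp add: algebra_simps)
        ultimately show ?thesis using step IH(6) by linarith
      qed
      ultimately show ?thesis using IH(3,4,5) xy sub
        by (intro exI[of _ ?T] exI[of _ X] exI[of _ N]) (auto intro: order_trans)
    qed
  qed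
qed

text \<open>With \<open>t = 2 ^ a\<close>, this is the part of the scan that the selected intervals
  do not pay for: at most \<open>k * 4 ^ a\<close> pieces, counting one more than the cuts, at the
  price \<open>t * t + 4 * t\<close> each.\<close>

definition strip_cost :: "nat \<Rightarrow> nat \<Rightarrow> nat" where
  "strip_cost k a = k * 4 ^ a * (2 ^ a * 2 ^ a + 4 * 2 ^ a)"

lemma strip_cost_pos: "1 \<le> k \<Longrightarrow> 1 \<le> strip_cost k a"
  by (simp add: strip_cost_def Suc_le_eq)

text \<open>Too many cuts would produce a grid: each recorded strip is a line whose points are the
  rows having an interval in it, and \<open>dense_lines_minor\<close> applies within the window of
  \<open>2 ^ a\<close> rows.\<close>

lemma strip_selection_no_minor:
  assumes "finite S" "row_disjoint S" "\<not> grid_minor k S" "1 \<le> k" "k \<le> Suc b"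
    and rows: "\<And>r c d. (r, c, d) \<in> S \<Longrightarrow> r \<in> {u..<u + 2 ^ a}"
  shows "\<exists>T. T \<subseteq> {(c, d). \<exists>r. (r, c, d) \<in> S} \<and> non_overlapping T \<and>
     card S \<le> strip_cost k a + (2 ^ b + 4) * card T"
proof -
  have "\<exists>T X N. T \<subseteq> {(c, d). \<exists>r. (r, c, d) \<in> S \<and> 0 \<le> c} \<and> non_overlapping T \<and>
     mono X \<and> 0 \<le> X 0 \<and>
     (\<forall>i<N. 2 ^ b \<le> card {r. \<exists>c d. (r, c, d) \<in> S \<and> X i \<le> c \<and> d < X (Suc i)}) \<and>
     card {(r, c, d) \<in> S. 0 \<le> c} \<le> (N + 1) * (2 ^ a * 2 ^ a + 4 * 2 ^ a) + (2 ^ b + 4) * card T"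
    by (rule strip_selection[OF assms(1,2) _ rows]) auto
  then obtain T X N where *: "T \<subseteq> {(c, d). \<exists>r. (r, c, d) \<in> S \<and> 0 \<le> c}" "non_overlapping T" "mono X"
     "\<And>i. i < N \<Longrightarrow> 2 ^ b \<le> card {r. \<exists>c d. (r, c, d) \<in> S \<and> X i \<le> c \<and> d < X (Suc i)}"
     "card {(r, c, d) \<in> S. 0 \<le> c} \<le> (N + 1) * (2 ^ a * 2 ^ a + 4 * 2 ^ a) + (2 ^ b + 4) * card T"
    by blast
  have "N < k * 4 ^ a"
  proof (rule ccontr)
    assume "\<not> N < k * 4 ^ a"
    then have N: "k * 4 ^ a \<le> card {..<N}" by simp
    define D where "D = (\<lambda>i. {r. \<exists>c d. (r, c, d) \<in> S \<and> X i \<le> c \<and> d < X (Suc i)})"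
    have D: "D i \<inter> {u..<u + 2 ^ a} = D i" for i using rows by (auto simp: D_def)
    have "\<exists>\<rho> \<gamma> :: nat \<Rightarrow> nat. mono \<rho> \<and> mono \<gamma> \<and> (\<forall>q. u \<le> \<gamma> q \<and> \<gamma> q \<le> u + 2 ^ a) \<and>
       (\<forall>p<k. \<forall>q<k. \<exists>i\<in>{..<N}. \<rho> p \<le> i \<and> i < \<rho> (Suc p) \<and> (\<exists>e\<in>D i. \<gamma> q \<le> e \<and> e < \<gamma> (Suc q)))"
      by (rule dense_lines_minor[OF _ assms(4,5) N]) (use *(4) in \<open>auto simp: D\<close>, simp add: D_def)
    then obtain \<rho> \<gamma> :: "nat \<Rightarrow> nat" where m: "mono \<rho>" "mono \<gamma>" and
      b: "\<And>p q. p < k \<Longrightarrow> q < k \<Longrightarrow>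
          \<exists>i\<in>{..<N}. \<rho> p \<le> i \<and> i < \<rho> (Suc p) \<and> (\<exists>e\<in>D i. \<gamma> q \<le> e \<and> e < \<gamma> (Suc q))"
      by blast
    \<comment> \<open>The lines are column strips, so the roles are exchanged:
      \<open>\<gamma>\<close> cuts the rows and \<open>X \<circ> \<rho>\<close> cuts the
      columns.\<close>
    have "\<exists>r c d. (r, c, d) \<in> S \<and> \<gamma> p \<le> r \<and> r < \<gamma> (Suc p) \<and> (X \<circ> \<rho>) q \<le> c \<and> d < (X \<circ> \<rho>) (Suc q)"
      if pq: "p < k" "q < k" for p q
    proof -
      obtain i e where ie: "\<rho> q \<le> i" "Suc i \<le> \<rho> (Suc q)" "e \<in> D i" "\<gamma> p \<le> e" "e < \<gamma> (Suc p)"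
        using b[OF pq(2,1)] by auto
      then obtain c d where cd: "(e, c, d) \<in> S" "X i \<le> c" "d < X (Suc i)" by (auto simp: D_def)
      have "X (\<rho> q) \<le> c" "d < X (\<rho> (Suc q))"
        using monoD[OF *(3) ie(1)] monoD[OF *(3) ie(2)] cd by simp_all
      then show ?thesis using cd ie by auto
    qed
    moreover have "mono (X \<circ> \<rho>)" using m *(3) by (auto simp: mono_def)
    ultimately show False using assms(3) m(2) unfolding grid_minor_def by blast
  qed
  then have "(N + 1) * (2 ^ a * 2 ^ a + 4 * 2 ^ a) \<le> strip_cost k a"
    unfolding strip_cost_def by (intro mult_right_mono) auto
  with *(5) have "card S \<le> strip_cost k a + (2 ^ b + 4) * card T" by simp
  with *(1,2) show ?thesis by auto
qed

section \<open>Contracting all row groups simultaneously\<close>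

lemma grid_minor_mono:
  assumes "grid_minor k S" "S \<subseteq> S'"
  shows "grid_minor k S'"
  by (rule grid_minor_map[OF assms(1), of "\<lambda>x. x" "\<lambda>x. x"]) (use assms(2) in \<open>auto simp: mono_def\<close>)

lemma mono_self: "mono (\<lambda>x :: nat. x)"
  by (rule monoI)

lemma mono_mult_right: "mono (\<lambda>x. x * t)" for t :: nat
  by (simp add: mono_def)

lemma div_cell:
  fixes t x :: nat
  assumes "0 < t"
  shows "x div t * t \<le> x" "x < Suc (x div t) * t"
  using assms by (simp_all add: dividend_less_div_times add.commute)

text \<open>Each group of \<open>2 ^ a\<close> consecutive rows is replaced by one row carrying its
  selected intervals, with columns unchanged. A grid in \<open>B\<close> blows up to one in
  \<open>S\<close>, as row \<open>g\<close> stands for the rows from \<open>g * 2 ^ a\<close> up to,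
  but excluding, \<open>Suc g * 2 ^ a\<close>.\<close>

lemma row_contraction:
  assumes "finite S" "row_disjoint S" "\<not> grid_minor k S" "1 \<le> k" "k \<le> Suc b"
    and rows: "\<And>r c d. (r, c, d) \<in> S \<Longrightarrow> r < n * 2 ^ a"
  shows "\<exists>B. finite B \<and> row_disjoint B \<and> \<not> grid_minor k B \<and>
     (\<forall>g c d. (g, c, d) \<in> B \<longrightarrow> g < n \<and> (\<exists>r. (r, c, d) \<in> S)) \<and>
     card S \<le> n * strip_cost k a + (2 ^ b + 4) * card B"
proof -
  let ?t = "2 ^ a :: nat"
  define G where "G = (\<lambda>g. {(r, c, d) \<in> S. r div ?t = g})"
  have "\<exists>T. T \<subseteq> {(c, d). \<exists>r. (r, c, d) \<in> G g} \<and> non_overlapping T \<and>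
     card (G g) \<le> strip_cost k a + (2 ^ b + 4) * card T" for g
  proof (rule strip_selection_no_minor[OF _ _ _ assms(4,5)])
    show "finite (G g)" by (rule finite_subset[OF _ assms(1)]) (auto simp: G_def)
    show "row_disjoint (G g)" by (rule row_disjoint_subset[OF assms(2)]) (auto simp: G_def)
    show "\<not> grid_minor k (G g)"
      using assms(3) grid_minor_mono[of k "G g" S] by (auto simp: G_def)
    show "r \<in> {g * ?t..<g * ?t + 2 ^ a}" if "(r, c, d) \<in> G g" for r c d
      using that div_cell[of ?t r] by (auto simp: G_def)
  qed
  then have "\<forall>g. \<exists>T. T \<subseteq> {(c, d). \<exists>r. (r, c, d) \<in> G g} \<and> non_overlapping T \<and>
     card (G g) \<le> strip_cost k a + (2 ^ b + 4) * card T" ..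
  from choice[OF this] obtain T where T: "\<And>g. T g \<subseteq> {(c, d). \<exists>r. (r, c, d) \<in> G g}" "\<And>g. non_overlapping (T g)"
     "\<And>g. card (G g) \<le> strip_cost k a + (2 ^ b + 4) * card (T g)" by blast
  have finT: "finite (T g)" for g
    by (rule finite_subset[of _ "snd ` S"]) (use T(1) assms(1) in \<open>force simp: G_def\<close>)+
  define B where "B = Sigma {..<n} T"
  have Biff: "(g, c, d) \<in> B \<longleftrightarrow> g < n \<and> (c, d) \<in> T g" for g c d by (auto simp: B_def)
  have lift: "\<exists>r. (r, c, d) \<in> S \<and> r div ?t = g" if "(g, c, d) \<in> B" for g c d
    using that T(1) by (fastforce simp: Biff G_def)
  have "row_disjoint B"
    unfolding row_disjoint_def
  proof
    fix g
    show "non_overlapping {(c, d). (g, c, d) \<in> B}"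
      using T(2)[of g] by (cases "g < n") (auto simp: Biff non_overlapping_def)
  qed
  moreover have "\<not> grid_minor k B"
  proof
    assume "grid_minor k B"
    moreover have "\<exists>r c' d'. (r, c', d') \<in> S \<and> g * ?t \<le> r \<and> r < Suc g * ?t \<and> c \<le> c' \<and> d' < Suc d"
      if "(g, c, d) \<in> B" for g c d
      using lift[OF that] div_cell[of ?t] by (metis lessI order_refl zero_less_numeral zero_less_power)
    ultimately have "grid_minor k S"
      by (rule grid_minor_map[OF _ mono_mult_right mono_self])
    then show False using assms(3) by simp
  qed
  moreover have "card S \<le> n * strip_cost k a + (2 ^ b + 4) * card B"
  proof -
    have "S \<subseteq> (\<Union>g<n. G g)"
      using rows by (fastforce simp: G_def less_mult_imp_div_less)
    moreover have "finite (G g)" for g by (rule finite_subset[OF _ assms(1)]) (auto simp: G_def)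
    ultimately have "card S \<le> card (\<Union>g<n. G g)" by (intro card_mono) auto
    also have "\<dots> \<le> (\<Sum>g<n. card (G g))" by (intro card_UN_le) auto
    also have "\<dots> \<le> (\<Sum>g<n. strip_cost k a + (2 ^ b + 4) * card (T g))" using T(3) by (intro sum_mono)
    also have "\<dots> = n * strip_cost k a + (2 ^ b + 4) * (\<Sum>g<n. card (T g))"
      by (simp add: sum.distrib sum_distrib_left)
    also have "(\<Sum>g<n. card (T g)) = card B"
      unfolding B_def using finT by (subst card_SigmaI) auto
    finally show ?thesis .
  qed
  moreover have "finite B" unfolding B_def using finT by auto
  ultimately show ?thesis using lift Biff by (intro exI[of _ B]) blast
qed

section \<open>Linear bounds\<close>

text \<open>Degenerate intervals encode sets of matrix positions, so that row contraction applies to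
  these as well.\<close>

definition points :: "(nat \<times> nat) set \<Rightarrow> (nat \<times> nat \<times> nat) set" where
  "points D = {(r, c, d). (r, c) \<in> D \<and> c = d}"

lemma points_iff [simp]: "(r, c, d) \<in> points D \<longleftrightarrow> (r, c) \<in> D \<and> c = d"
  by (simp add: points_def)

lemma points_eq_image: "points D = (\<lambda>(r, c). (r, c, c)) ` D"
  by (auto simp: points_def)

lemma finite_points [simp]: "finite D \<Longrightarrow> finite (points D)"
  by (simp add: points_eq_image)

lemma card_points [simp]: "card (points D) = card D"
  unfolding points_eq_image by (intro card_image inj_onI) auto

lemma row_disjoint_points: "row_disjoint (points D)"
  by (auto simp: row_disjoint_def non_overlapping_def)

text \<open>For degenerate intervals rows and columns play symmetric roles, so exchanging the two
  cut sequences suffices. This lets row contraction act on columns.\<close>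

lemma grid_minor_points_converse:
  assumes "grid_minor k (points (D\<inverse>))"
  shows "grid_minor k (points D)"
proof -
  obtain \<rho> \<gamma> where m: "mono \<rho>" "mono \<gamma>" and "\<forall>p<k. \<forall>q<k. \<exists>r c d. (r, c, d) \<in> points (D\<inverse>) \<and>
      \<rho> p \<le> r \<and> r < \<rho> (Suc p) \<and> \<gamma> q \<le> c \<and> d < \<gamma> (Suc q)"
    using assms unfolding grid_minor_def by blast
  then have "\<forall>p<k. \<forall>q<k. \<exists>r c d. (r, c, d) \<in> points D \<and>
      \<gamma> p \<le> r \<and> r < \<gamma> (Suc p) \<and> \<rho> q \<le> c \<and> d < \<rho> (Suc q)"
    by (simp add: points_iff) blast
  with m show ?thesis unfolding grid_minor_def by blast
qed

text \<open>The selected intervals are among the given ones, so they are degenerate again and the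
  result is still a set of positions.\<close>

lemma row_contraction_points:
  assumes "D \<subseteq> {..<n * 2 ^ a} \<times> {..<m}" "\<not> grid_minor k (points D)" "1 \<le> k" "k \<le> Suc b"
  shows "\<exists>D'. D' \<subseteq> {..<n} \<times> {..<m} \<and> \<not> grid_minor k (points D') \<and>
     card D \<le> n * strip_cost k a + (2 ^ b + 4) * card D'"
proof -
  have "finite D" using assms(1) by (rule finite_subset) simp
  then obtain B where B: "\<not> grid_minor k B"
     "\<forall>g c d. (g, c, d) \<in> B \<longrightarrow> g < n \<and> (\<exists>r. (r, c, d) \<in> points D)"
     "card (points D) \<le> n * strip_cost k a + (2 ^ b + 4) * card B"
    using row_contraction[OF _ row_disjoint_points assms(2-4), of n a] assms(1) by fastforce
  define D' where "D' = {(g, c). (g, c, c) \<in> B}"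
  have "B = points D'" using B(2) by (auto simp: D'_def points_def)
  moreover have "D' \<subseteq> {..<n} \<times> {..<m}" using B(2) assms(1) by (fastforce simp: D'_def)
  ultimately show ?thesis using B(1,3) by auto
qed

text \<open>Contracting rows and then, after transposition, columns divides both dimensions by
  \<open>2 ^ a\<close>. Each contraction loses a factor \<open>2 ^ b + 4\<close>, and the assumption
  on \<open>a\<close> makes \<open>2 ^ a\<close> exceed the square of this factor by enough to close
  the induction.\<close>

lemma card_points_le:
  assumes "1 \<le> k" "k \<le> Suc b" "2 * (2 ^ b + 4)\<^sup>2 \<le> (2 ^ a :: nat)"
  shows "D \<subseteq> {..<(2 ^ a) ^ i} \<times> {..<(2 ^ a) ^ i} \<Longrightarrow> \<not> grid_minor k (points D) \<Longrightarrow>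
     card D \<le> (2 ^ b + 5) * strip_cost k a * (2 ^ a) ^ i"
proof (induction i arbitrary: D)
  case 0
  then have "card D \<le> card ({..<1::nat} \<times> {..<1::nat})" by (intro card_mono) auto
  also have "\<dots> \<le> (2 ^ b + 5) * strip_cost k a"
    using strip_cost_pos[OF \<open>1 \<le> k\<close>, of a] by (auto simp: Suc_le_eq)
  finally show ?case by simp
next
  case (Suc i)
  let ?n = "(2 ^ a) ^ i :: nat" and ?s = "2 ^ b + 4 :: nat" and ?c = "strip_cost k a"
  let ?K = "(2 ^ b + 5) * ?c"
  have "D \<subseteq> {..<?n * 2 ^ a} \<times> {..<?n * 2 ^ a}" using Suc.prems by (simp add: mult.commute)
  then have "\<exists>D1. D1 \<subseteq> {..<?n} \<times> {..<?n * 2 ^ a} \<and> \<not> grid_minor k (points D1) \<and>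
      card D \<le> ?n * ?c + ?s * card D1"
    by (intro row_contraction_points[OF _ Suc.prems(2) assms(1,2)])
  then obtain D1 where D1: "D1 \<subseteq> {..<?n} \<times> {..<?n * 2 ^ a}" "\<not> grid_minor k (points D1)"
      "card D \<le> ?n * ?c + ?s * card D1"
    by blast
  have "\<not> grid_minor k (points (D1\<inverse>))" using D1(2) grid_minor_points_converse by blast
  moreover have "D1\<inverse> \<subseteq> {..<?n * 2 ^ a} \<times> {..<?n}" using D1(1) by auto
  ultimately have "\<exists>D2. D2 \<subseteq> {..<?n} \<times> {..<?n} \<and> \<not> grid_minor k (points D2) \<and>
      card (D1\<inverse>) \<le> ?n * ?c + ?s * card D2"
    by (intro row_contraction_points[OF _ _ assms(1,2)])
  then obtain D2 where D2: "D2 \<subseteq> {..<?n} \<times> {..<?n}" "\<not> grid_minor k (points D2)"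
      "card (D1\<inverse>) \<le> ?n * ?c + ?s * card D2"
    by blast
  have "card D \<le> ?n * ?c + ?s * (?n * ?c + ?s * card D2)"
    using D1(3) D2(3) by (simp add: card_inverse) (meson add_left_mono mult_le_mono2 order_trans)
  also have "\<dots> \<le> ?n * ?c + ?s * (?n * ?c + ?s * (?K * ?n))"
    using Suc.IH[OF D2(1,2)] by (intro add_left_mono mult_left_mono) auto
  \<comment> \<open>Since \<open>2 ^ b + 5 = ?s + 1\<close>, the two additive terms sum to
    \<open>?K * ?n\<close>; this explains the factor in \<open>?K\<close>.\<close>
  also have "\<dots> = (1 + ?s\<^sup>2) * (?K * ?n)" by (simp add: algebra_simps power2_eq_square)
  also have "\<dots> \<le> 2 ^ a * (?K * ?n)"
  proof (rule mult_right_mono)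
    have "1 \<le> ?s\<^sup>2" by simp
    then show "1 + ?s\<^sup>2 \<le> 2 ^ a" using assms(3) by linarith
  qed simp
  finally show ?case by (simp add: algebra_simps)
qed

text \<open>Proper intervals cannot be transposed, so after the row contraction the columns are
  merged by integer division. Intervals inside one column group are charged to the bound for points,
  and the others go to the induction hypothesis.\<close>

lemma card_chunks_le:
  assumes "1 \<le> k" "k \<le> Suc b" "2 * (2 ^ b + 4)\<^sup>2 \<le> (2 ^ a :: nat)"
  shows "finite S \<Longrightarrow> row_disjoint S \<Longrightarrow> \<not> grid_minor k S \<Longrightarrow>
     (\<And>r c d. (r, c, d) \<in> S \<Longrightarrow> r < (2 ^ a) ^ i \<and> d < (2 ^ a) ^ i) \<Longrightarrow>
     card S \<le> (strip_cost k a + (2 ^ b + 4) * ((2 ^ b + 5) * strip_cost k a * (2 ^ a * 2 ^ a))) * (2 ^ a) ^ i"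
proof (induction i arbitrary: S)
  case 0
  have "S \<subseteq> {(0, 0, 0)}" using 0(4) row_disjointD(1)[OF 0(2)] by fastforce
  then have "card S \<le> card {(0 :: nat, 0 :: nat, 0 :: nat)}" by (intro card_mono) auto
  also have "\<dots> \<le> strip_cost k a" using strip_cost_pos[OF \<open>1 \<le> k\<close>, of a] by simp
  finally show ?case by simp
next
  case (Suc i)
  let ?t = "2 ^ a :: nat" and ?s = "2 ^ b + 4 :: nat" and ?c = "strip_cost k a"
  let ?n = "?t ^ i"
  let ?K = "(2 ^ b + 5) * ?c"
  let ?K' = "?c + ?s * (?K * (?t * ?t))"
  have t: "0 < ?t" by simp
  have "\<exists>B. finite B \<and> row_disjoint B \<and> \<not> grid_minor k B \<and>
     (\<forall>g c d. (g, c, d) \<in> B \<longrightarrow> g < ?n \<and> (\<exists>r. (r, c, d) \<in> S)) \<and> card S \<le> ?n * ?c + ?s * card B"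
    by (rule row_contraction[OF Suc.prems(1-3) assms(1,2)])
       (use Suc.prems(4) in \<open>auto simp: mult.commute\<close>)
  then obtain B where B: "finite B" "row_disjoint B" "\<not> grid_minor k B"
     "\<And>g c d. (g, c, d) \<in> B \<Longrightarrow> g < ?n \<and> (\<exists>r. (r, c, d) \<in> S)"
     "card S \<le> ?n * ?c + ?s * card B"
    by blast
  have cd: "c \<le> d" "g < ?n" "c div ?t < ?n" "d div ?t < ?n" if "(g, c, d) \<in> B" for g c d
  proof -
    show "c \<le> d" using row_disjointD(1)[OF B(2) that] .
    have "d < ?n * ?t" using B(4)[OF that] Suc.prems(4) by (auto simp: mult.commute)
    then show "c div ?t < ?n" "d div ?t < ?n" using \<open>c \<le> d\<close> by (auto intro!: less_mult_imp_div_less)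
    show "g < ?n" using B(4)[OF that] by simp
  qed
  define F where "F = {(g, c, d) \<in> B. c div ?t = d div ?t}"
  define G where "G = {(g, c, d) \<in> B. c div ?t \<noteq> d div ?t}"
  have finFG: "finite F" "finite G"
    by (rule finite_subset[OF _ B(1)], auto simp: F_def G_def)+
  have "B = F \<union> G" by (auto simp: F_def G_def)
  then have cardB: "card B \<le> card F + card G" using card_Un_le by metis
  \<comment> \<open>The cells holding an interval of \<open>F\<close>. Each holds at most
    \<open>?t * ?t\<close> of them, since the two remainders modulo \<open>?t\<close> determine the
    interval within its cell.\<close>
  define D where "D = {(g, c div ?t) | g c d. (g, c, d) \<in> F}"
  have D: "D \<subseteq> {..<?n} \<times> {..<?n}" using cd by (auto simp: D_def F_def)
  have "\<not> grid_minor k (points D)"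
  proof
    assume "grid_minor k (points D)"
    moreover have "\<exists>r c d. (r, c, d) \<in> B \<and> r' \<le> r \<and> r < Suc r' \<and> c' * ?t \<le> c \<and> d < Suc d' * ?t"
      if "(r', c', d') \<in> points D" for r' c' d'
    proof -
      from that obtain c d where "(r', c, d) \<in> B" "c' = c div ?t" "d' = d div ?t"
        by (auto simp: D_def F_def)
      then show ?thesis using div_cell[OF t] by blast
    qed
    ultimately have "grid_minor k B"
      by (rule grid_minor_map[OF _ mono_self mono_mult_right])
    then show False using B(3) by simp
  qed
  then have cardD: "card D \<le> ?K * ?n" using card_points_le[OF assms D] by simp
  have "card F \<le> card (D \<times> ({..<?t} \<times> {..<?t}))"
  proof (rule card_inj_on_le)
    show "inj_on (\<lambda>(g, c, d). ((g, c div ?t), (c mod ?t, d mod ?t))) F"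
      by (rule inj_onI) (auto simp: F_def, (metis div_mult_mod_eq)+)
    show "(\<lambda>(g, c, d). ((g, c div ?t), (c mod ?t, d mod ?t))) ` F \<subseteq> D \<times> ({..<?t} \<times> {..<?t})"
      by (auto simp: D_def)
    show "finite (D \<times> ({..<?t} \<times> {..<?t}))" using finite_subset[OF D] by simp
  qed
  also have "\<dots> = card D * (?t * ?t)" by (simp add: card_cartesian_product)
  also have "\<dots> \<le> ?K * ?n * (?t * ?t)" using cardD by (intro mult_right_mono) auto
  finally have cardF: "card F \<le> ?K * ?n * (?t * ?t)" .
  let ?h = "\<lambda>(g :: nat, c, d). (g, c div ?t, d div ?t)"
  \<comment> \<open>Intervals of \<open>G\<close> keep positive length after division. Distinct ones
    in a row still lie one after the other, so their images cannot coincide.\<close>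
  have sep: "(c div ?t, d div ?t) \<noteq> (c' div ?t, d' div ?t) \<and>
      (d div ?t \<le> c' div ?t \<or> d' div ?t \<le> c div ?t)"
    if G: "(g, c, d) \<in> G" "(g, c', d') \<in> G" and ne: "(c, d) \<noteq> (c', d')" for g c d c' d'
  proof -
    have B': "(g, c, d) \<in> B" "(g, c', d') \<in> B" using G by (auto simp: G_def)
    have "c div ?t < d div ?t" if "(g, c, d) \<in> G" for c d
      using that div_le_mono[OF cd(1), of g c d ?t] by (auto simp: G_def)
    then have lt: "c div ?t < d div ?t" "c' div ?t < d' div ?t" using G by blast+
    from row_disjointD(2)[OF B(2) B' ne]
    have "d div ?t \<le> c' div ?t \<or> d' div ?t \<le> c div ?t" using div_le_mono by blast
    then show ?thesis using lt by auto
  qed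
  have "card (?h ` G) \<le> ?K' * ?n"
  proof (rule Suc.IH)
    show "finite (?h ` G)" using finFG by simp
    show "row_disjoint (?h ` G)"
      unfolding row_disjoint_def non_overlapping_def
    proof (intro allI conjI ballI; clarsimp)
      show "c div ?t \<le> d div ?t" if "(g, c, d) \<in> G" for g c d
        using that cd(1) by (auto simp: G_def intro: div_le_mono)
      show "d div ?t \<le> c' div ?t"
        if "(g, c, d) \<in> G" "(g, c', d') \<in> G" "c div ?t = c' div ?t \<longrightarrow> d div ?t \<noteq> d' div ?t"
          "\<not> d' div ?t \<le> c div ?t" for g c d c' d'
        using sep[OF that(1,2)] that(3,4) by auto
    qed
    show "\<not> grid_minor k (?h ` G)"
    proof
      assume "grid_minor k (?h ` G)"
      moreover have "\<exists>r c d. (r, c, d) \<in> B \<and> r' \<le> r \<and> r < Suc r' \<and> c' * ?t \<le> c \<and> d < Suc d' * ?t"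
        if "(r', c', d') \<in> ?h ` G" for r' c' d'
      proof -
        from that obtain c d where "(r', c, d) \<in> B" "c' = c div ?t" "d' = d div ?t"
          by (auto simp: G_def)
        then show ?thesis using div_cell[OF t] by blast
      qed
      ultimately have "grid_minor k B"
        by (rule grid_minor_map[OF _ mono_self mono_mult_right])
      then show False using B(3) by simp
    qed
    show "r < ?n \<and> d < ?n" if "(r, c, d) \<in> ?h ` G" for r c d
      using that cd by (auto simp: G_def)
  qed
  moreover have "card (?h ` G) = card G"
  proof (intro card_image inj_onI)
    fix z z' assume z: "z \<in> G" "z' \<in> G" "?h z = ?h z'"
    obtain g c d g' c' d' where eq: "z = (g, c, d)" "z' = (g', c', d')" by (metis prod_cases3)
    show "z = z'" using sep[of g c d c' d'] z unfolding eq by auto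
  qed
  ultimately have cardG: "card G \<le> ?K' * ?n" by simp
  have "card S \<le> ?n * ?c + ?s * (card F + card G)"
    using B(5) cardB by (meson add_left_mono mult_le_mono2 order_trans)
  also have "\<dots> \<le> ?n * ?c + ?s * (?K * ?n * (?t * ?t) + ?K' * ?n)"
    using cardF cardG by (intro add_left_mono mult_left_mono add_mono) auto
  \<comment> \<open>\<open>?K'\<close> is chosen as the sum of the additive terms per row, so these
    contribute \<open>?K' * ?n\<close> and the inductive part contributes \<open>?s\<close> times as
    much.\<close>
  also have "\<dots> = (1 + ?s) * (?K' * ?n)" by (simp only: algebra_simps)
  also have "\<dots> \<le> ?t * (?K' * ?n)"
  proof (rule mult_right_mono)
    have "1 + s \<le> 2 * s\<^sup>2" if "1 \<le> s" for s :: nat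
      using self_le_power[OF that, of 2] that by linarith
    from this[of ?s] show "1 + ?s \<le> ?t" using assms(3) by linarith
  qed simp
  finally show ?case by (simp only: power_Suc mult.left_commute)
qed

section \<open>Ordered graphs\<close>

text \<open>The first \<open>j\<close> elements are cut off repeatedly; the final summand
  \<open>j\<close> pays for the fewer than \<open>j\<close> elements left at the end.\<close>

lemma chunk_partition:
  fixes X :: "nat set"
  assumes "finite X" "1 \<le> j"
  shows "\<exists>I. finite I \<and> non_overlapping I \<and>
     (\<forall>c d. (c, d) \<in> I \<longrightarrow> c \<in> X \<and> d \<in> X \<and> j \<le> card (X \<inter> {c..d})) \<and> card X \<le> j * card I + j"
  using assms(1)
proof (induction "card X" arbitrary: X rule: less_induct)
  case less
  show ?case
  proof (cases "card X < j")
    case True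
    then show ?thesis by (intro exI[of _ "{}"]) (auto simp: non_overlapping_def)
  next
    case False
    then have "X \<noteq> {}" using assms(2) by auto
    \<comment> \<open>Minimality makes \<open>d\<close> the \<open>j\<close>-th smallest element, so
      the chunk from \<open>Min X\<close> to \<open>d\<close> uses up exactly \<open>j\<close>
      elements.\<close>
    define d where "d = (LEAST d. d \<in> X \<and> j \<le> card (X \<inter> {..d}))"
    have "X \<inter> {..Max X} = X" using less.prems by auto
    then have "Max X \<in> X \<and> j \<le> card (X \<inter> {..Max X})"
      using False Max_in[OF less.prems \<open>X \<noteq> {}\<close>] by simp
    then have d: "d \<in> X" "j \<le> card (X \<inter> {..d})"
      unfolding d_def by (metis (mono_tags, lifting) LeastI)+
    have "card (X \<inter> {..<d}) < j"
    proof (cases "X \<inter> {..<d} = {}")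
      case True
      then show ?thesis using assms(2) by simp
    next
      case ne: False
      let ?m = "Max (X \<inter> {..<d})"
      have m: "?m \<in> X \<inter> {..<d}" using Max_in[OF _ ne] less.prems by simp
      have "X \<inter> {..<d} = X \<inter> {..?m}"
        using m less.prems by (auto intro: Max_ge)
      moreover have "\<not> (?m \<in> X \<and> j \<le> card (X \<inter> {..?m}))"
        using m not_less_Least[of ?m "\<lambda>d. d \<in> X \<and> j \<le> card (X \<inter> {..d})"] unfolding d_def[symmetric] by auto
      ultimately show ?thesis using m by auto
    qed
    moreover have "X \<inter> {..d} = insert d (X \<inter> {..<d})" using d(1) by auto
    ultimately have cd: "card (X \<inter> {..d}) \<le> j" using less.prems by simp
    let ?c = "Min X" and ?X = "X \<inter> {d<..}"
    have c: "?c \<in> X" "?c \<le> d" using less.prems \<open>X \<noteq> {}\<close> d(1) by auto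
    have "X = (X \<inter> {..d}) \<union> ?X" by auto
    then have cX: "card X = card (X \<inter> {..d}) + card ?X"
      using less.prems by (subst card_Un_disjoint[symmetric]) auto
    then have "card ?X < card X" using d(2) assms(2) by simp
    from less.hyps[OF this] less.prems obtain I where I: "finite I" "non_overlapping I"
      "\<And>c d. (c, d) \<in> I \<Longrightarrow> c \<in> ?X \<and> d \<in> ?X \<and> j \<le> card (?X \<inter> {c..d})" "card ?X \<le> j * card I + j"
      by auto
    have "(?c, d) \<notin> I" using I(3) c by fastforce
    then have "card X \<le> j * card (insert (?c, d) I) + j" using I(1,4) cX cd by simp
    moreover have "non_overlapping (insert (?c, d) I)"
      using I(2,3) c(2) unfolding non_overlapping_def by fastforce
    moreover have "c' \<in> X \<and> d' \<in> X \<and> j \<le> card (X \<inter> {c'..d'})" if "(c', d') \<in> insert (?c, d) I" for c' d'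
    proof (cases "(c', d') \<in> I")
      case True
      have "card (?X \<inter> {c'..d'}) \<le> card (X \<inter> {c'..d'})" using less.prems by (intro card_mono) auto
      then show ?thesis using I(3)[OF True] by auto
    next
      case False
      moreover have "X \<inter> {?c..d} = X \<inter> {..d}" using less.prems by auto
      ultimately show ?thesis using that d c by auto
    qed
    ultimately show ?thesis using I(1) by (intro exI[of _ "insert (?c, d) I"]) blast
  qed
qed

section \<open>From grids of chunks to containment\<close>

lemma permutation_matrixE:
  assumes "permutation_matrix k P"
  obtains \<pi> \<sigma> where "\<And>a. a < k \<Longrightarrow> \<pi> a < k \<and> P $$ (a, \<pi> a) = 1" "\<And>b. b < k \<Longrightarrow> \<sigma> b < k"
    "\<And>a b. a < k \<Longrightarrow> b < k \<Longrightarrow> P $$ (a, b) = 1 \<longleftrightarrow> a = \<sigma> b"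
    "\<And>b. b < k \<Longrightarrow> \<pi> (\<sigma> b) = b"
proof -
  have r: "\<forall>a<k. \<exists>!b. b < k \<and> P $$ (a, b) = 1" and c: "\<forall>b<k. \<exists>!a. a < k \<and> P $$ (a, b) = 1"
    using assms unfolding permutation_matrix_def by auto
  from r have "\<forall>a. \<exists>b. a < k \<longrightarrow> b < k \<and> P $$ (a, b) = 1" by blast
  from choice[OF this] obtain \<pi> where \<pi>: "\<And>a. a < k \<Longrightarrow> \<pi> a < k \<and> P $$ (a, \<pi> a) = 1" by blast
  from c have "\<forall>b. \<exists>a. b < k \<longrightarrow> a < k \<and> P $$ (a, b) = 1" by blast
  from choice[OF this] obtain \<sigma> where \<sigma>: "\<And>b. b < k \<Longrightarrow> \<sigma> b < k \<and> P $$ (\<sigma> b, b) = 1" by blast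
  show thesis
  proof (rule that[of \<pi> \<sigma>])
    show "\<pi> a < k \<and> P $$ (a, \<pi> a) = 1" if "a < k" for a using \<pi> that .
    show "\<sigma> b < k" if "b < k" for b using \<sigma> that by simp
    show "P $$ (a, b) = 1 \<longleftrightarrow> a = \<sigma> b" if "a < k" "b < k" for a b
      using \<sigma> c that by blast
    show "\<pi> (\<sigma> b) = b" if "b < k" for b
      using \<pi> \<sigma> r that by blast
  qed
qed

lemma graph_of_widen:
  assumes "dim_row P = k" "dim_col P = k"
  shows "verts (graph_of_matrix (widen j P)) = {1..k + k * j}"
    and "edges (graph_of_matrix (widen j P)) =
      {{Suc a, k + Suc b} | a b. a < k \<and> b < k * j \<and> P $$ (a, b div j) = 1}"
proof -
  have wd: "dim_row (widen j P) = k" "dim_col (widen j P) = k * j"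
    "\<And>a b. a < k \<Longrightarrow> b < k * j \<Longrightarrow> widen j P $$ (a, b) = P $$ (a, b div j)"
    by (simp_all add: widen_def assms)
  show "verts (graph_of_matrix (widen j P)) = {1..k + k * j}"
    by (simp add: graph_of_matrix_def wd)
  show "edges (graph_of_matrix (widen j P)) =
      {{Suc a, k + Suc b} | a b. a < k \<and> b < k * j \<and> P $$ (a, b div j) = 1}"
    by (simp add: graph_of_matrix_def wd cong: conj_cong)
qed

text \<open>\<open>h\<close> enumerates vertices of \<open>G\<close> in increasing order, and all
  chunks lie above the diagonal. The grid has one row block and one column block more than the
  permutation; they serve to place all row vertices of \<open>Q\<close> before all its column
  vertices.\<close>

lemma contains_tuple_permutation_graph:
  fixes G :: "'a :: linorder graph" and h :: "nat \<Rightarrow> 'a"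
  assumes "tuple_permutation_graph j k Q"
    and h: "strict_mono_on {..<n} h" "h ` {..<n} \<subseteq> verts G"
    and S: "\<And>r c d. (r, c, d) \<in> S \<Longrightarrow> r < c \<and> c \<le> d \<and>
         j \<le> card ({v. r < v \<and> v < n \<and> {h r, h v} \<in> edges G} \<inter> {c..d})"
    and n: "\<And>r c d. (r, c, d) \<in> S \<Longrightarrow> r < n"
    and minor: "grid_minor (Suc k) S"
  shows "contains G Q"
proof -
  obtain P where P: "permutation_matrix k P" and Q: "Q = graph_of_matrix (widen j P)"
    using assms(1) unfolding tuple_permutation_graph_def tuple_permutation_matrix_def by blast
  have dim: "dim_row P = k" "dim_col P = k" using P by (auto simp: permutation_matrix_def)
  \<comment> \<open>Both directions of the permutation occur: chunks are chosen row by row, while a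
    column of \<open>Q\<close> has to look up its row.\<close>
  obtain \<pi> \<sigma> where \<pi>: "\<And>a. a < k \<Longrightarrow> \<pi> a < k \<and> P $$ (a, \<pi> a) = 1" and \<sigma>: "\<And>b. b < k \<Longrightarrow> \<sigma> b < k"
    and P1: "\<And>a b. a < k \<Longrightarrow> b < k \<Longrightarrow> P $$ (a, b) = 1 \<longleftrightarrow> a = \<sigma> b"
    and inv: "\<And>b. b < k \<Longrightarrow> \<pi> (\<sigma> b) = b"
    by (rule permutation_matrixE[OF P]) (rule that)
  obtain \<rho> \<gamma> where m: "mono \<rho>" "mono \<gamma>" and blocks: "\<And>p q. p < Suc k \<Longrightarrow> q < Suc k \<Longrightarrow>
      \<exists>r c d. (r, c, d) \<in> S \<and> \<rho> p \<le> r \<and> r < \<rho> (Suc p) \<and> \<gamma> q \<le> c \<and> d < \<gamma> (Suc q)"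
    using minor unfolding grid_minor_def by blast
  \<comment> \<open>Column block \<open>0\<close> and row block \<open>k\<close> stay free for the
    corner, hence the shift to \<open>Suc (\<pi> a)\<close>.\<close>
  have "\<forall>a. \<exists>r c d. a < k \<longrightarrow> (r, c, d) \<in> S \<and> \<rho> a \<le> r \<and> r < \<rho> (Suc a) \<and>
      \<gamma> (Suc (\<pi> a)) \<le> c \<and> d < \<gamma> (Suc (Suc (\<pi> a)))"
  proof
    fix a
    show "\<exists>r c d. a < k \<longrightarrow> (r, c, d) \<in> S \<and> \<rho> a \<le> r \<and> r < \<rho> (Suc a) \<and>
      \<gamma> (Suc (\<pi> a)) \<le> c \<and> d < \<gamma> (Suc (Suc (\<pi> a)))"
      using blocks[of a "Suc (\<pi> a)"] \<pi>[of a] by (cases "a < k") auto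
  qed
  then obtain row C D where rCD: "\<And>a. a < k \<Longrightarrow> (row a, C a, D a) \<in> S \<and> \<rho> a \<le> row a \<and>
      row a < \<rho> (Suc a) \<and> \<gamma> (Suc (\<pi> a)) \<le> C a \<and> D a < \<gamma> (Suc (Suc (\<pi> a)))"
    by metis
  define Y where "Y = (\<lambda>q. {v. row (\<sigma> q) < v \<and> v < n \<and> {h (row (\<sigma> q)), h v} \<in> edges G} \<inter> {C (\<sigma> q)..D (\<sigma> q)})"
  \<comment> \<open>Column \<open>b\<close> goes to the element with index \<open>b mod j\<close> of
    the chunk of its block \<open>b div j\<close>; \<open>cardY\<close> guarantees that it
    exists.\<close>
  define col where "col = (\<lambda>b. sorted_list_of_set (Y (b div j)) ! (b mod j))"
  have finY: "finite (Y q)" for q by (simp add: Y_def)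
  have cardY: "j \<le> card (Y q)" if "q < k" for q
    using S rCD[OF \<sigma>[OF that]] unfolding Y_def by blast
  have Yrange: "\<gamma> (Suc q) \<le> v" "v < \<gamma> (Suc (Suc q))" if "q < k" "v \<in> Y q" for q v
    using rCD[OF \<sigma>[OF that(1)]] that(2) unfolding inv[OF that(1)] by (auto simp: Y_def)
  have bdiv: "b div j < k" "b mod j < j" if "b < k * j" for b
    using that by (auto intro: less_mult_imp_div_less) (metis gr_zeroI less_nat_zero_code mod_less_divisor mult_0_right)
  have colY: "col b \<in> Y (b div j)" if "b < k * j" for b
  proof -
    have "b mod j < length (sorted_list_of_set (Y (b div j)))"
      using bdiv[OF that] cardY[OF bdiv(1)[OF that]] by simp
    then show ?thesis unfolding col_def using finY by (metis nth_mem set_sorted_list_of_set)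
  qed
  have col_less: "col b < col b'" if b: "b < b'" "b' < k * j" for b b'
  proof (cases "b div j = b' div j")
    case True
    have "b mod j < b' mod j" using b(1) True by (metis div_mult_mod_eq nat_add_left_cancel_less)
    moreover have "b' mod j < length (sorted_list_of_set (Y (b' div j)))"
      using bdiv[OF b(2)] cardY[OF bdiv(1)[OF b(2)]] by simp
    ultimately show ?thesis unfolding col_def True
      by (intro sorted_wrt_nth_less[OF strict_sorted_list_of_set])
  next
    case False
    then have q: "Suc (b div j) \<le> b' div j" using div_le_mono[of b b' j] b(1) by simp
    have "b < k * j" using b by simp
    have "col b < \<gamma> (Suc (Suc (b div j)))" using Yrange(2) bdiv colY \<open>b < k * j\<close> by blast
    also have "\<dots> \<le> \<gamma> (Suc (b' div j))" using q by (intro monoD[OF m(2)]) simp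
    also have "\<dots> \<le> col b'" using Yrange(1) bdiv colY b(2) by blast
    finally show ?thesis .
  qed
  have row_less: "row a < row a'" if "a < a'" "a' < k" for a a'
  proof -
    have "row a < \<rho> (Suc a)" using rCD that by simp
    also have "\<dots> \<le> \<rho> a'" using that by (intro monoD[OF m(1)]) simp
    also have "\<dots> \<le> row a'" using rCD that by simp
    finally show ?thesis .
  qed
  \<comment> \<open>The lower left block holds a chunk above the diagonal, so
    \<open>\<rho> k \<le> r0 < c0 \<le> d0 < \<gamma> (Suc 0)\<close>.\<close>
  obtain r0 c0 d0 where corner: "(r0, c0, d0) \<in> S" "\<rho> k \<le> r0" "d0 < \<gamma> (Suc 0)"
    using blocks[of k 0] by auto
  have row_col: "row a < col b" if "a < k" "b < k * j" for a b
  proof -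
    have "row a < \<rho> (Suc a)" using rCD that by simp
    also have "\<dots> \<le> \<rho> k" using that by (intro monoD[OF m(1)]) simp
    also have "\<rho> k < \<gamma> (Suc 0)" using corner S[OF corner(1)] by linarith
    also have "\<dots> \<le> \<gamma> (Suc (b div j))" by (intro monoD[OF m(2)]) simp
    also have "\<dots> \<le> col b" using Yrange(1) bdiv colY that(2) by blast
    finally show ?thesis .
  qed
  \<comment> \<open>Vertices of \<open>Q\<close> count from \<open>1\<close>: row \<open>a\<close>
    is the vertex \<open>Suc a\<close> and column \<open>b\<close> is
    \<open>k + Suc b\<close>.\<close>
  define f0 where "f0 = (\<lambda>v. if v \<le> k then row (v - 1) else col (v - k - 1))"
  note vQ = graph_of_widen(1)[OF dim, of j, folded Q]
  note eQ = graph_of_widen(2)[OF dim, of j, folded Q]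
  have f0_less: "f0 v < f0 w" if "v \<in> verts Q" "w \<in> verts Q" "v < w" for v w
    using that row_less row_col col_less unfolding vQ f0_def by auto
  have f0_n: "f0 v < n" if "v \<in> verts Q" for v
  proof (cases "v \<le> k")
    case True
    then have "v - 1 < k" using that by (auto simp: vQ)
    then have "row (v - 1) < n" using rCD n by blast
    then show ?thesis using True by (simp add: f0_def)
  next
    case False
    then show ?thesis using that colY[of "v - k - 1"] by (auto simp: f0_def vQ Y_def)
  qed
  define f where "f = h \<circ> f0"
  have mono: "strict_mono_on (verts Q) f"
    using f0_less f0_n strict_mono_onD[OF h(1)] by (auto simp: strict_mono_on_def f_def)
  have "inj_on f (verts Q)" using mono by (rule strict_mono_on_imp_inj_on)
  moreover have "edges Q \<subseteq> Pow (verts Q)" unfolding vQ eQ by auto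
  ultimately have inj: "inj_on ((`) f) (edges Q)"
    by (meson inj_on_image_Pow inj_on_subset)
  have edge: "f ` e \<in> edges G" if "e \<in> edges Q" for e
  proof -
    from that obtain a b where ab: "e = {Suc a, k + Suc b}" "a < k" "b < k * j" "P $$ (a, b div j) = 1"
      unfolding eQ by auto
    then have "a = \<sigma> (b div j)" using P1 bdiv by blast
    then have "{h (row a), h (col b)} \<in> edges G" using colY[OF ab(3)] by (auto simp: Y_def)
    moreover have "f ` e = {h (row a), h (col b)}" using ab by (auto simp: f_def f0_def)
    ultimately show ?thesis by simp
  qed
  have "f ` verts Q \<subseteq> verts G" using f0_n h(2) by (auto simp: f_def)
  then show ?thesis
    unfolding contains_def using mono inj edge by (intro exI[of _ f] exI[of _ "(`) f"]) auto
qed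

section \<open>Edge count and choice of parameters\<close>

lemma power_between:
  fixes t n :: nat
  assumes "2 \<le> t" "1 \<le> n"
  shows "\<exists>i. n \<le> t ^ i \<and> t ^ i \<le> t * n"
proof -
  have ex: "n \<le> t ^ n"
    using less_exp[of n] power_mono[OF assms(1), of n] by linarith
  define i where "i = (LEAST i. n \<le> t ^ i)"
  have i: "n \<le> t ^ i" unfolding i_def using ex by (rule LeastI)
  show ?thesis
  proof (cases i)
    case 0
    then show ?thesis using assms i by (intro exI[of _ 0]) auto
  next
    case (Suc i')
    then have "\<not> n \<le> t ^ i'" using not_less_Least[of i' "\<lambda>i. n \<le> t ^ i"] unfolding i_def[symmetric] by simp
    then have "t ^ i \<le> t * n" using Suc by simp
    then show ?thesis using i by blast
  qed
qed

text \<open>Each edge is counted at its smaller end. Chunks account for \<open>j\<close> edges each,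
  the leftovers for at most \<open>j\<close> per row, and rounding \<open>n\<close> up to a power of
  \<open>2 ^ a\<close> costs one more factor \<open>2 ^ a\<close>.\<close>

lemma card_edges_le:
  fixes G :: "nat graph"
  assumes "ordered_graph G" "finite (verts G)" "card (verts G) = n" "avoids G Q"
    and "tuple_permutation_graph j k Q" "1 \<le> j" "1 \<le> n"
    and "Suc k \<le> Suc b" "2 * (2 ^ b + 4)\<^sup>2 \<le> (2 ^ a :: nat)"
  shows "card (edges G) \<le> j * ((strip_cost (Suc k) a +
     (2 ^ b + 4) * ((2 ^ b + 5) * strip_cost (Suc k) a * (2 ^ a * 2 ^ a))) * (2 ^ a * n)) + j * n"
proof -
  let ?t = "2 ^ a :: nat"
  let ?K = "strip_cost (Suc k) a + (2 ^ b + 4) * ((2 ^ b + 5) * strip_cost (Suc k) a * (?t * ?t))"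
  define h where "h = (!) (sorted_list_of_set (verts G))"
  have len: "length (sorted_list_of_set (verts G)) = n" using assms(3) by simp
  have "h ` {..<n} = set (sorted_list_of_set (verts G))"
    using len by (auto simp: h_def set_conv_nth)
  moreover have "strict_mono_on {..<n} h"
    unfolding strict_mono_on_def h_def
    using sorted_wrt_nth_less[OF strict_sorted_list_of_set[of "verts G"]] len by auto
  ultimately have h: "strict_mono_on {..<n} h" "h ` {..<n} = verts G" using assms(2) by simp_all
  define X where "X = (\<lambda>r. {v. r < v \<and> v < n \<and> {h r, h v} \<in> edges G})"
  have finX: "finite (X r)" for r by (simp add: X_def)
  have "\<forall>r. \<exists>I. finite I \<and> non_overlapping I \<and>
     (\<forall>c d. (c, d) \<in> I \<longrightarrow> c \<in> X r \<and> d \<in> X r \<and> j \<le> card (X r \<inter> {c..d})) \<and> card (X r) \<le> j * card I + j"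
    using chunk_partition[OF finX assms(6)] by blast
  from choice[OF this] obtain I where I: "\<And>r. finite (I r)" "\<And>r. non_overlapping (I r)"
    "\<And>r c d. (c, d) \<in> I r \<Longrightarrow> c \<in> X r \<and> d \<in> X r \<and> j \<le> card (X r \<inter> {c..d})"
    "\<And>r. card (X r) \<le> j * card (I r) + j" by blast
  define S where "S = Sigma {..<n} I"
  have finS: "finite S" unfolding S_def using I(1) by auto
  have disj: "row_disjoint S"
    unfolding row_disjoint_def
  proof
    fix r
    show "non_overlapping {(c, d). (r, c, d) \<in> S}"
      using I(2)[of r] by (cases "r < n") (auto simp: S_def non_overlapping_def)
  qed
  have Sprops: "r < n" "r < c \<and> c \<le> d \<and> j \<le> card (X r \<inter> {c..d})" "d < n" if "(r, c, d) \<in> S" for r c d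
    using that I(3)[of c d r] row_disjointD(1)[OF disj that] by (auto simp: S_def X_def)
  have no_minor: "\<not> grid_minor (Suc k) S"
    using contains_tuple_permutation_graph[OF assms(5) h(1), of G S] h(2) Sprops assms(4)
    unfolding X_def by blast
  have "edges G \<subseteq> (\<lambda>(r, v). {h r, h v}) ` Sigma {..<n} X"
  proof
    fix e assume e: "e \<in> edges G"
    then have "card e = 2" "e \<subseteq> h ` {..<n}" using assms(1) h(2) by (auto simp: ordered_graph_def)
    then obtain x' y' where "e = {x', y'}" "x' \<noteq> y'" "x' \<in> h ` {..<n}" "y' \<in> h ` {..<n}"
      by (auto simp: card_2_iff)
    then obtain x y where xy: "e = {h x, h y}" "x < n" "y < n" "x \<noteq> y" by blast
    have 1: "{h r, h v} \<in> (\<lambda>(r, v). {h r, h v}) ` Sigma {..<n} X"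
      if "r < v" "v < n" "{h r, h v} \<in> edges G" for r v
      using that by (intro image_eqI[of _ _ "(r, v)"]) (auto simp: X_def)
    from xy(4) consider "x < y" | "y < x" by linarith
    then show "e \<in> (\<lambda>(r, v). {h r, h v}) ` Sigma {..<n} X"
      using 1[of x y] 1[of y x] xy e by cases (auto simp: insert_commute)
  qed
  then have "card (edges G) \<le> card (Sigma {..<n} X)"
    using finX by (intro surj_card_le) auto
  also have "\<dots> = (\<Sum>r<n. card (X r))" using finX by simp
  also have "\<dots> \<le> (\<Sum>r<n. j * card (I r) + j)" using I(4) by (intro sum_mono)
  also have "\<dots> = j * card S + j * n"
    unfolding S_def using I(1) by (simp add: sum.distrib sum_distrib_left)
  finally have E: "card (edges G) \<le> j * card S + j * n" .
  \<comment> \<open>This makes \<open>a\<close> positive and hence \<open>?t\<close> at least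
    \<open>2\<close>, as rounding to a power of \<open>?t\<close> requires.\<close>
  have "k < a"
  proof -
    have "(2::nat) ^ b + 4 \<le> (2 ^ b + 4)\<^sup>2" by (rule self_le_power) auto
    then have "(2::nat) ^ Suc b \<le> 2 ^ a" using assms(9) by simp
    then have "Suc b \<le> a" by (subst (asm) power_increasing_iff) auto
    then show ?thesis using assms(8) by simp
  qed
  then have "2 \<le> ?t" using self_le_power[of "2::nat" a] by simp
  then obtain i where i: "n \<le> ?t ^ i" "?t ^ i \<le> ?t * n" using power_between assms(7) by blast
  have "r < ?t ^ i \<and> d < ?t ^ i" if "(r, c, d) \<in> S" for r c d
    using Sprops(1,3)[OF that] i(1) by simp
  then have "card S \<le> ?K * ?t ^ i"
    by (intro card_chunks_le[OF _ assms(8,9) finS disj no_minor]) auto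
  also have "\<dots> \<le> ?K * (?t * n)" using i(2) by (intro mult_left_mono) auto
  finally have "j * card S \<le> j * (?K * (?t * n))" by (intro mult_left_mono) auto
  with E show ?thesis by linarith
qed

text \<open>Here \<open>T\<close> stands for \<open>2 ^ a\<close>, \<open>u\<close> for
  \<open>2 ^ b\<close>, \<open>q\<close> for \<open>Suc k\<close> and \<open>c\<close> for the strip
  cost. Every factor is bounded by a power of \<open>T\<close>, and further factors \<open>T\<close>
  absorb the constants.\<close>

lemma cost_power_bound:
  fixes T u q :: nat
  assumes T: "128 \<le> T" "u + 5 \<le> T" "q \<le> T"
  defines "c \<equiv> q * (T * T) * (T * T + 4 * T)"
  shows "(c + (u + 4) * ((u + 5) * c * (T * T))) * T + 1 \<le> T ^ 13"
proof -
  have "T + 4 \<le> T * T" using mult_le_mono1[OF T(1), of T] T by linarith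
  from mult_le_mono2[OF this, of T] have "T * T + 4 * T \<le> T * (T * T)" by (simp add: algebra_simps)
  then have "c \<le> T * (T * T) * (T * (T * T))"
    unfolding c_def using T(3) by (intro mult_le_mono) auto
  also have "\<dots> = T ^ 6" by (simp add: eval_nat_numeral)
  finally have cost: "c \<le> T ^ 6" .
  have "(u + 4) * ((u + 5) * c * (T * T)) \<le> T * (T * T ^ 6 * (T * T))"
    using T(2) cost by (intro mult_le_mono) auto
  also have "\<dots> = T ^ 10" by (simp add: eval_nat_numeral)
  finally have "c + (u + 4) * ((u + 5) * c * (T * T)) \<le> T ^ 6 + T ^ 10" using cost by linarith
  also have "\<dots> \<le> 2 * T ^ 10" using power_increasing[of 6 10 T] T(1) by simp
  also have "\<dots> \<le> T * T ^ 10" using T(1) by (intro mult_right_mono) auto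
  finally have "(c + (u + 4) * ((u + 5) * c * (T * T))) * T + 1 \<le> T * T ^ 10 * T + 1"
    by (intro add_right_mono mult_right_mono) auto
  also have "T * T ^ 10 * T = T ^ 12" by (simp add: eval_nat_numeral)
  also have "T ^ 12 + 1 \<le> 2 * T ^ 12" using T(1) by (simp add: Suc_le_eq)
  also have "\<dots> \<le> T * T ^ 12" using T(1) by (intro mult_right_mono) auto
  also have "\<dots> = T ^ 13" by (simp add: eval_nat_numeral)
  finally show ?thesis .
qed

text \<open>As \<open>a = 2 * b + 3\<close>, the group size is \<open>8 * u\<^sup>2\<close> for
  \<open>u = 2 ^ b\<close>, and \<open>u \<ge> 4\<close> gives
  \<open>2 * (u + 4)\<^sup>2 \<le> 8 * u\<^sup>2\<close>. The exponent comes from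
  \<open>a \<le> 7 * k\<close> and \<open>13 * 7 = 91\<close>.\<close>

lemma cost_bound:
  assumes "1 \<le> k"
  defines "b \<equiv> Suc k" and "a \<equiv> 2 * k + 5"
  shows "2 * (2 ^ b + 4)\<^sup>2 \<le> (2 ^ a :: nat)"
    and "(strip_cost (Suc k) a + (2 ^ b + 4) * ((2 ^ b + 5) * strip_cost (Suc k) a * (2 ^ a * 2 ^ a))) * 2 ^ a + 1
       \<le> (2 ^ (91 * k) :: nat)"
proof -
  obtain u T :: nat where u: "u = 2 ^ b" and T: "T = 2 ^ a" by blast
  have "4 \<le> u" using power_increasing[of 2 b "2::nat"] assms(1) by (simp add: u b_def)
  have "a = 3 + b * 2" by (simp add: a_def b_def)
  then have T_eq: "T = 8 * u\<^sup>2" unfolding T u by (simp only: power_add power_mult) simp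
  have "(u + 4)\<^sup>2 \<le> (2 * u)\<^sup>2" using \<open>4 \<le> u\<close> by (intro power_mono) auto
  then have "2 * (u + 4)\<^sup>2 \<le> T" unfolding T_eq by (simp add: power_mult_distrib)
  then show "2 * (2 ^ b + 4)\<^sup>2 \<le> (2 ^ a :: nat)" by (simp only: u T)
  have "4 * u \<le> u\<^sup>2" using \<open>4 \<le> u\<close> by (simp add: power2_eq_square)
  then have uT: "u + 5 \<le> T" "128 \<le> T" using \<open>4 \<le> u\<close> unfolding T_eq by linarith+
  have "Suc k \<le> u" using less_exp[of "Suc k"] unfolding u b_def by simp
  then have "Suc k \<le> T" using uT by simp
  have four: "4 ^ a = T * T" unfolding T by (simp flip: power_mult_distrib)
  have cost: "strip_cost (Suc k) a = Suc k * (T * T) * (T * T + 4 * T)"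
    unfolding strip_cost_def four by (simp only: T)
  have "(strip_cost (Suc k) a + (u + 4) * ((u + 5) * strip_cost (Suc k) a * (T * T))) * T + 1 \<le> T ^ 13"
    unfolding cost by (rule cost_power_bound[OF uT(2,1) \<open>Suc k \<le> T\<close>])
  also have "\<dots> = 2 ^ (a * 13)" by (simp only: T power_mult)
  also have "\<dots> \<le> 2 ^ (91 * k)" using assms(1) by (intro power_increasing) (auto simp: a_def)
  finally show "(strip_cost (Suc k) a + (2 ^ b + 4) * ((2 ^ b + 5) * strip_cost (Suc k) a * (2 ^ a * 2 ^ a)))
      * 2 ^ a + 1 \<le> (2 ^ (91 * k) :: nat)" by (simp only: u T)
qed

text \<open>An edge of \<open>Q\<close> ensures that the maximum in \<open>gex\<close> is taken over
  a nonempty set and hence attained.\<close>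

lemma tuple_permutation_graph_edges:
  assumes "tuple_permutation_graph j k Q" "1 \<le> j" "1 \<le> k"
  shows "edges Q \<noteq> {}"
proof -
  obtain P where P: "permutation_matrix k P" and Q: "Q = graph_of_matrix (widen j P)"
    using assms(1) unfolding tuple_permutation_graph_def tuple_permutation_matrix_def by blast
  have dim: "dim_row P = k" "dim_col P = k" using P by (auto simp: permutation_matrix_def)
  have "\<forall>a<k. \<exists>!b. b < k \<and> P $$ (a, b) = 1" and "0 < k"
    using P assms(3) by (simp_all add: permutation_matrix_def)
  then have "\<exists>!b. b < k \<and> P $$ (0, b) = 1" by simp
  then obtain b where b: "b < k" "P $$ (0, b) = 1" by blast
  then have "b * j < k * j" "b * j div j = b" using assms(2) by auto
  then have "{Suc 0, k + Suc (b * j)} \<in> edges Q"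
    unfolding Q graph_of_widen(2)[OF dim] using b(2) assms(3)
    by (intro CollectI exI[of _ 0] exI[of _ "b * j"]) simp
  then show ?thesis by blast
qed

theorem corollary2p6:
  fixes j :: nat
  assumes "j \<ge> 1"
  shows "\<exists>C::real. C > 0 \<and>
    (\<forall>(k::nat) (n::nat) (Q::nat graph).
       k \<ge> 1 \<longrightarrow> n \<ge> 1 \<longrightarrow> tuple_permutation_graph j k Q \<longrightarrow>
       real (gex Q n) \<le> 2 powr (C * real k) * real n)"
proof (intro exI[of _ "91 + real j"] conjI allI impI)
  show "91 + real j > 0" by simp
  fix k n :: nat and Q :: "nat graph"
  assume k: "k \<ge> 1" and n: "n \<ge> 1" and Q: "tuple_permutation_graph j k Q"
  let ?b = "Suc k" and ?a = "2 * k + 5"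
  have "gex Q n \<in> gex_set Q n"
    unfolding gex_def using tuple_permutation_graph_edges[OF Q assms k]
    by (intro Max_in finite_gex_set gex_set_nonempty)
  then obtain G :: "nat graph" where G: "gex Q n = card (edges G)" "ordered_graph G"
      "finite (verts G)" "card (verts G) = n" "avoids G Q"
    unfolding gex_set_def by blast
  let ?K = "strip_cost (Suc k) ?a +
      (2 ^ ?b + 4) * ((2 ^ ?b + 5) * strip_cost (Suc k) ?a * (2 ^ ?a * 2 ^ ?a))"
  have "gex Q n \<le> j * (?K * (2 ^ ?a * n)) + j * n"
    unfolding G(1) by (rule card_edges_le[OF G(2-5) Q assms n _ cost_bound(1)[OF k]]) simp
  also have "\<dots> = j * n * (?K * 2 ^ ?a + 1)" by (simp add: algebra_simps)
  also have "\<dots> \<le> j * n * 2 ^ (91 * k)" using cost_bound(2)[OF k] by (intro mult_left_mono) auto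
  \<comment> \<open>The factor \<open>j\<close> is absorbed by \<open>2 ^ (j * k)\<close>, which is
    the reason for the summand \<open>j\<close> in the constant.\<close>
  also have "\<dots> \<le> 2 ^ (j * k) * n * 2 ^ (91 * k)"
  proof (intro mult_right_mono)
    have "j < 2 ^ j" by (rule less_exp)
    also have "(2::nat) ^ j \<le> 2 ^ (j * k)" using k by (intro power_increasing) auto
    finally show "j \<le> 2 ^ (j * k)" by simp
  qed auto
  also have "\<dots> = 2 ^ ((91 + j) * k) * n" by (simp add: power_add algebra_simps)
  finally have "real (gex Q n) \<le> real (2 ^ ((91 + j) * k) * n)" by (rule of_nat_mono)
  also have "\<dots> = 2 powr real ((91 + j) * k) * real n" by (subst powr_realpow) auto
  also have "real ((91 + j) * k) = (91 + real j) * real k" by simp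
  finally show "real (gex Q n) \<le> 2 powr ((91 + real j) * real k) * real n" .
qed

end
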